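(* Let $n\geqslant2$ and let $\mathbb{S}$ be the unit sphere of $\mathbb{R}^n$. Let $g:\mathbb{R}_+\to\mathbb{R}$ be a smooth decreasing function such that $g(t)\to0$ as $t\to+\infty$ and $g(0)<\frac12$. Then there exists a probability density function $f_0$ on $\mathbb{S}$ such that the solution $f(t,\cdot)$ of $$\partial_tf+\nabla_v\cdot(fP_{v^\perp}J_f)=0,\qquad J_f(t)=\int_{\mathbb{S}}v\,f(t,v)\,\mathrm{d}v,$$ with initial condition $f_0$ converges weakly, as $t\to+\infty$, to $\delta_{\Omega_\infty}$ for some $\Omega_\infty\in\mathbb{S}$, but is such that $W_1(f(t,\cdot),\delta_{\Omega_\infty})\geqslant g(t)$ for all $t\geqslant0$.
   Context: For $v\in\mathbb{S}$ and $u\in\mathbb{R}^n$, $P_{v^\perp}u=u-(v\cdot u)v$. $\nabla_v$ and $\nabla_v\cdot$ are the gradient and divergence on $\mathbb{S}$. A probability density function on $\mathbb{S}$ is a density with respect to the Lebesgue (surface) measure on $\mathbb{S}$. $\mathcal{P}(\mathbb{S})$ is the set of Borel probability measures on $\mathbb{S}$. The solution is the unique weakly continuous family $f\in C(\mathbb{R}_+,\mathcal{P}(\mathbb{S}))$ with $f(0,\cdot)=f_0$ such that for all $t\geqslant0$ and $\varphi\in C^1(\mathbb{S})$, $\frac{\mathrm{d}}{\mathrm{d}t}\int_{\mathbb{S}}\varphi(v)f(t,v)\,\mathrm{d}v=\int_{\mathbb{S}}J_f(t)\cdot\nabla_v\varphi(v)f(t,v)\,\mathrm{d}v$ (where $f(t,v)\,\mathrm{d}v$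 denotes integration against the measure $f(t,\cdot)$). The Wasserstein distance $W_1$ is $W_1(\mu,\nu)=\sup_{\varphi\in\mathrm{Lip}_1(\mathbb{S})}\left|\int_{\mathbb{S}}\varphi\,\mathrm{d}\mu-\int_{\mathbb{S}}\varphi\,\mathrm{d}\nu\right|$, where $\mathrm{Lip}_1(\mathbb{S})$ is the set of functions $\varphi:\mathbb{S}\to\mathbb{R}$ with $|\varphi(u)-\varphi(v)|\leqslant|u-v|$ (Euclidean norm of $\mathbb{R}^n$) for all $u,v\in\mathbb{S}$. *)

theory Defs
  imports "HOL-Probability.Probability"
begin

abbreviation unit_sphere :: "(real ^ 'n) set" where
  "unit_sphere \<equiv> sphere 0 1"

definition sphere_borel :: "(real ^ 'n) measure" where
  "sphere_borel = restrict_space borel unit_sphere"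

text \<open>Surface measure, in polar coordinates: the measure of a Borel set \<open>A\<close> of the sphere is \<open>n\<close> times
  the Lebesgue measure of the cone \<open>{r v | 0 < r \<le> 1, v \<in> A}\<close>. Here \<open>sgn x = x /\<^sub>R norm x\<close>.\<close>

definition sphere_measure :: "(real ^ 'n) measure" where
  "sphere_measure =
     scale_measure (of_nat CARD('n)) (distr (restrict_space lborel (cball 0 1 - {0})) sphere_borel sgn)"

definition sphere_pdf :: "(real ^ 'n \<Rightarrow> real) \<Rightarrow> bool" where
  "sphere_pdf f0 \<longleftrightarrow> f0 \<in> borel_measurable sphere_measure \<and> (\<forall>v\<in>unit_sphere. 0 \<le> f0 v) \<and>
     (\<integral>\<^sup>+ v. ennreal (f0 v) \<partial>sphere_measure) = 1"

definition sphere_prob :: "(real ^ 'n) measure \<Rightarrow> bool" where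
  "sphere_prob \<mu> \<longleftrightarrow> sets \<mu> = sets sphere_borel \<and> prob_space \<mu>"

definition sphere_weak_tendsto :: "('t \<Rightarrow> (real ^ 'n) measure) \<Rightarrow> (real ^ 'n) measure \<Rightarrow> 't filter \<Rightarrow> bool" where
  "sphere_weak_tendsto f \<mu> F \<longleftrightarrow>
     (\<forall>\<phi>. continuous_on unit_sphere \<phi> \<longrightarrow> ((\<lambda>t. \<integral>v. (\<phi> v :: real) \<partial>f t) \<longlongrightarrow> (\<integral>v. \<phi> v \<partial>\<mu>)) F)"

text \<open>The differential of \<open>\<phi>\<close> at \<open>v\<close> along the sphere is only determined on the tangent space \<open>v\<^sup>\<bottom>\<close>; the
  gradient is the tangent vector that represents it.\<close>

definition has_sphere_grad :: "(real ^ 'n \<Rightarrow> real) \<Rightarrow> real ^ 'n \<Rightarrow> real ^ 'n \<Rightarrow> bool" where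
  "has_sphere_grad \<phi> G v \<longleftrightarrow> v \<bullet> G = 0 \<and> (\<phi> has_derivative (\<lambda>h. G \<bullet> h)) (at v within unit_sphere)"

definition sphere_grad :: "(real ^ 'n \<Rightarrow> real) \<Rightarrow> real ^ 'n \<Rightarrow> real ^ 'n" where
  "sphere_grad \<phi> v = (THE G. has_sphere_grad \<phi> G v)"

lemma has_sphere_grad_unique:
  fixes v G H :: "real ^ 'n"
  assumes v: "v \<in> unit_sphere" and G: "has_sphere_grad \<phi> G v" and H: "has_sphere_grad \<phi> H v"
  shows "G = H"
proof (rule ccontr)
  assume "G \<noteq> H"
  define u where "u = sgn (G - H)"
  have u: "norm u = 1" "v \<bullet> u = 0"
    using \<open>G \<noteq> H\<close> G H by (simp_all add: u_def norm_sgn sgn_div_norm has_sphere_grad_def inner_diff_right)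
  define c where "c = (\<lambda>t::real. cos t *\<^sub>R v + sin t *\<^sub>R u)"
  have "norm (c t) = 1" for t
  proof -
    have "c t \<bullet> c t = (cos t)\<^sup>2 * (v \<bullet> v) + (sin t)\<^sup>2 * (u \<bullet> u)"
      using u(2) by (simp add: c_def inner_add_left inner_add_right inner_commute[of u v] power2_eq_square)
    then show ?thesis
      using u(1) v by (simp add: norm_eq_1)
  qed
  then have c: "range c \<subseteq> unit_sphere"
    by auto
  have c': "(c has_derivative (\<lambda>s. s *\<^sub>R u)) (at 0)"
    unfolding c_def by (auto intro!: derivative_eq_intros)
  have "((\<phi> \<circ> c) has_derivative (\<lambda>h. K \<bullet> h) \<circ> (\<lambda>s. s *\<^sub>R u)) (at 0)" if "has_sphere_grad \<phi> K v" for K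
  proof (rule diff_chain_within[OF c'])
    show "(\<phi> has_derivative (\<lambda>h. K \<bullet> h)) (at (c 0) within range c)"
      using that c by (auto simp: has_sphere_grad_def c_def intro: has_derivative_subset)
  qed
  from has_derivative_unique[OF this[OF G] this[OF H]]
  have "G \<bullet> u = H \<bullet> u"
    by (auto simp: fun_eq_iff dest: spec[of _ 1])
  then have "(G - H) \<bullet> (G - H) = 0"
    by (simp add: u_def sgn_div_norm inner_diff_left \<open>G \<noteq> H\<close>)
  then show False
    using \<open>G \<noteq> H\<close> by simp
qed

lemma sphere_grad_eq:
  "v \<in> unit_sphere \<Longrightarrow> has_sphere_grad \<phi> G v \<Longrightarrow> sphere_grad \<phi> v = G"
  unfolding sphere_grad_def by (blast intro: has_sphere_grad_unique)

definition C1_sphere :: "(real ^ 'n \<Rightarrow> real) \<Rightarrow> bool" where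
  "C1_sphere \<phi> \<longleftrightarrow>
     (\<forall>v\<in>unit_sphere. \<exists>G. has_sphere_grad \<phi> G v) \<and> continuous_on unit_sphere (sphere_grad \<phi>)"

definition mean_vector :: "(real ^ 'n) measure \<Rightarrow> real ^ 'n" where
  "mean_vector \<mu> = (\<integral>v. v \<partial>\<mu>)"

text \<open>Weak solutions of \<open>\<partial>\<^sub>t f + \<nabla>\<^sub>v \<cdot> (f P\<^bsub>v\<^sup>\<bottom>\<^esub> J\<^sub>f) = 0\<close>. The projection disappears from the weak form since
  the gradient is tangent. The values of \<open>f\<close> at negative times are irrelevant.\<close>

definition alignment_solution :: "(real ^ 'n) measure \<Rightarrow> (real \<Rightarrow> (real ^ 'n) measure) \<Rightarrow> bool" where
  "alignment_solution \<mu>0 f \<longleftrightarrow>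
     (\<forall>t\<ge>0. sphere_prob (f t)) \<and>
     (\<forall>t\<ge>0. sphere_weak_tendsto f (f t) (at t within {0..})) \<and>
     f 0 = \<mu>0 \<and>
     (\<forall>t\<ge>0. \<forall>\<phi>. C1_sphere \<phi> \<longrightarrow>
        ((\<lambda>s. \<integral>v. \<phi> v \<partial>f s) has_real_derivative
           (\<integral>v. mean_vector (f t) \<bullet> sphere_grad \<phi> v \<partial>f t)) (at t within {0..}))"

definition is_the_alignment_solution :: "(real ^ 'n) measure \<Rightarrow> (real \<Rightarrow> (real ^ 'n) measure) \<Rightarrow> bool" where
  "is_the_alignment_solution \<mu>0 f \<longleftrightarrow>
     alignment_solution \<mu>0 f \<and> (\<forall>f'. alignment_solution \<mu>0 f' \<longrightarrow> (\<forall>t\<ge>0. f' t = f t))"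

text \<open>For probability measures on the sphere the supremum is over a set bounded by 2.\<close>

definition W1 :: "(real ^ 'n) measure \<Rightarrow> (real ^ 'n) measure \<Rightarrow> real" where
  "W1 \<mu> \<nu> = (SUP \<phi>\<in>{\<phi>. 1-lipschitz_on unit_sphere \<phi>}. \<bar>(\<integral>v. \<phi> v \<partial>\<mu>) - (\<integral>v. \<phi> v \<partial>\<nu>)\<bar>)"

definition smooth_halfline :: "(real \<Rightarrow> real) \<Rightarrow> bool" where
  "smooth_halfline g \<longleftrightarrow> (\<exists>D :: nat \<Rightarrow> real \<Rightarrow> real. (\<forall>t\<ge>0. D 0 t = g t) \<and>
     (\<forall>k. \<forall>t\<ge>0. (D k has_real_derivative D (Suc k) t) (at t within {0..})))"

end

theory Submission
  imports Defs
begin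

text \<open>\<^bold>\<open>The idea.\<close> Take an initial density that depends only on \<open>x = e \<bullet> v\<close>, where \<open>e\<close> is a coordinate axis.
The mean \<open>J\<close> then stays on the line through \<open>e\<close>. If \<open>e \<bullet> J > 0\<close> initially, this remains true, and
every particle tends to \<open>e\<close>, except one that sits exactly at \<open>- e\<close>. As \<open>\<bar>J\<bar> \<le> 1\<close>, a particle
needs a time at least \<open>t\<close> to get from \<open>x \<le> - tanh t\<close> to the upper hemisphere, and until then it is at
distance at least \<open>1\<close> from \<open>e\<close>. So \<open>W1 (f t) \<delta>\<^sub>e\<close> is at least the mass that \<open>f0\<close> puts on
\<open>{x \<le> - tanh t}\<close>, and \<open>f0\<close> can be chosen so that this mass is at least \<open>g t\<close>: the shell
\<open>- tanh (j + 2) < x \<le> - tanh (j + 1)\<close> receives the mass \<open>g j - g (j + 1)\<close>. The remaining mass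
\<open>1 - g 0 > 1 / 2\<close> goes to a cap around \<open>e\<close> and makes \<open>e \<bullet> J\<close> positive
(\<open>exists_slowly_escaping_density\<close>, \<open>mass_le_W1_boost\<close>).

\<^bold>\<open>Existence.\<close> The field \<open>v \<mapsto> e - (e \<bullet> v) v\<close> has an explicit flow on the sphere, the Lorentz boost
\<open>boost e s\<close>. A solution with mean on the axis is the image of \<open>\<mu>\<close> under \<open>boost e (s t)\<close>, where the clock
\<open>s\<close> solves the scalar autonomous equation \<open>s' = H s\<close> with \<open>H s = e \<bullet> \<integral> boost e s v d\<mu>\<close>. Inverting
an antiderivative of \<open>1 / H\<close> solves it (\<open>autonomous_ode_solution\<close>, \<open>axisymmetric_solution\<close>).

\<^bold>\<open>Uniqueness.\<close> No flow is needed here. The moments \<open>\<integral> \<Prod>\<^sub>i (a\<^sub>i \<bullet> v) df\<close> satisfy an infinite system in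
which the derivative of a moment of degree \<open>k\<close> involves \<open>k\<close> moments of degree \<open>k - 1\<close> and \<open>k\<close> times one
of degree \<open>k + 1\<close>. The factor \<open>k\<close> grows only linearly, so iterating the system \<open>N\<close> times bounds the
difference of two solutions after time \<open>\<tau>\<close> by a constant times \<open>(4 \<tau>) ^ N * (k + N choose N)\<close>. This
tends to \<open>0\<close> for small \<open>\<tau>\<close>, uniformly in the starting time, so the moments agree for all times. By the
Weierstrass approximation theorem they determine the measure (\<open>alignment_solution_unique\<close>).\<close>

section \<open>Probability measures on the sphere\<close>

lemma sets_sphere_borel: "sets (sphere_borel :: (real ^ 'n) measure) = {A \<in> sets borel. A \<subseteq> unit_sphere}"
  unfolding sphere_borel_def by (auto simp: sets_restrict_space_iff subset_iff)

lemma space_sphere_borel [simp]: "space (sphere_borel :: (real ^ 'n) measure) = unit_sphere"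
  by (simp add: sphere_borel_def space_restrict_space)

lemma borel_measurable_sphere_borel:
  fixes \<phi> :: "real ^ 'n \<Rightarrow> 'b::topological_space"
  assumes "continuous_on unit_sphere \<phi>"
  shows "\<phi> \<in> borel_measurable sphere_borel"
  unfolding sphere_borel_def by (rule borel_measurable_continuous_on_restrict[OF assms])

lemma measurable_sphere_borelI:
  fixes \<Phi> :: "real ^ 'n \<Rightarrow> real ^ 'n"
  assumes "continuous_on unit_sphere \<Phi>" "\<And>v. v \<in> unit_sphere \<Longrightarrow> \<Phi> v \<in> unit_sphere"
  shows "\<Phi> \<in> measurable sphere_borel sphere_borel"
  using borel_measurable_sphere_borel[OF assms(1)] assms(2)
  by (subst sphere_borel_def) (auto intro!: measurable_restrict_space2)

lemma sphere_prob_sets: "sphere_prob \<mu> \<Longrightarrow> sets \<mu> = sets sphere_borel"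
  and sphere_prob_prob_space: "sphere_prob \<mu> \<Longrightarrow> prob_space \<mu>"
  by (simp_all add: sphere_prob_def)

lemma sphere_prob_space:
  fixes \<mu> :: "(real ^ 'n) measure"
  assumes "sphere_prob \<mu>" shows "space \<mu> = unit_sphere"
  using sets_eq_imp_space_eq[OF sphere_prob_sets[OF assms]] by simp

lemma sphere_prob_measurable:
  fixes \<mu> :: "(real ^ 'n) measure" and \<phi> :: "real ^ 'n \<Rightarrow> 'b::topological_space"
  assumes "sphere_prob \<mu>" "continuous_on unit_sphere \<phi>"
  shows "\<phi> \<in> borel_measurable \<mu>"
  using borel_measurable_sphere_borel[OF assms(2)] sphere_prob_sets[OF assms(1)]
  by (simp cong: measurable_cong_sets)

lemma continuous_on_sphere_bounded:
  fixes \<phi> :: "real ^ 'n \<Rightarrow> 'b::real_normed_vector"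
  assumes "continuous_on unit_sphere \<phi>"
  obtains B where "\<And>v. v \<in> unit_sphere \<Longrightarrow> norm (\<phi> v) \<le> B"
proof -
  have "bounded (\<phi> ` unit_sphere)"
    using assms by (intro compact_imp_bounded compact_continuous_image) auto
  then show ?thesis using that unfolding bounded_iff by blast
qed

lemma sphere_prob_integrable:
  fixes \<mu> :: "(real ^ 'n) measure" and \<phi> :: "real ^ 'n \<Rightarrow> 'b::{banach, second_countable_topology}"
  assumes "sphere_prob \<mu>" "continuous_on unit_sphere \<phi>"
  shows "integrable \<mu> \<phi>"
proof -
  interpret prob_space \<mu> by (rule sphere_prob_prob_space[OF assms(1)])
  obtain B where B: "\<And>v. v \<in> unit_sphere \<Longrightarrow> norm (\<phi> v) \<le> B"
    using continuous_on_sphere_bounded[OF assms(2)] by blast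
  show ?thesis
    by (rule integrable_const_bound[of _ B])
       (use B sphere_prob_space[OF assms(1)] sphere_prob_measurable[OF assms] in auto)
qed

lemma sphere_prob_integral_norm_le:
  fixes \<mu> :: "(real ^ 'n) measure" and \<phi> :: "real ^ 'n \<Rightarrow> 'b::{banach, second_countable_topology}"
  assumes \<mu>: "sphere_prob \<mu>" and "continuous_on unit_sphere \<phi>"
    and "\<And>v. v \<in> unit_sphere \<Longrightarrow> norm (\<phi> v) \<le> B"
  shows "norm (\<integral>v. \<phi> v \<partial>\<mu>) \<le> B"
proof -
  interpret prob_space \<mu> by (rule sphere_prob_prob_space[OF \<mu>])
  have "norm (\<integral>v. \<phi> v \<partial>\<mu>) \<le> (\<integral>v. norm (\<phi> v) \<partial>\<mu>)"
    by (rule integral_norm_bound)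
  also have "\<dots> \<le> (\<integral>v. B \<partial>\<mu>)"
    using assms(2,3) sphere_prob_space[OF \<mu>]
    by (intro integral_mono sphere_prob_integrable[OF \<mu>] continuous_intros) auto
  also have "\<dots> = B"
    by (simp add: prob_space)
  finally show ?thesis .
qed

lemma norm_mean_vector_le_1:
  fixes \<mu> :: "(real ^ 'n) measure"
  assumes "sphere_prob \<mu>" shows "norm (mean_vector \<mu>) \<le> 1"
  unfolding mean_vector_def
  by (rule sphere_prob_integral_norm_le[OF assms]) (auto intro!: continuous_intros)

text \<open>The indicator of a closed set \<open>C\<close> is the limit of the continuous functions
\<open>max 0 (1 - k * infdist v C)\<close>, and closed sets generate the Borel sets.\<close>

lemma sphere_prob_eqI:
  fixes \<mu> \<nu> :: "(real ^ 'n) measure"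
  assumes \<mu>: "sphere_prob \<mu>" and \<nu>: "sphere_prob \<nu>"
    and eq: "\<And>\<phi>. continuous_on unit_sphere \<phi> \<Longrightarrow> (\<integral>v. (\<phi> v :: real) \<partial>\<mu>) = (\<integral>v. \<phi> v \<partial>\<nu>)"
  shows "\<mu> = \<nu>"
proof -
  define E where "E \<rho> = distr \<rho> borel (\<lambda>v::real ^ 'n. v)" for \<rho>
  have meas: "(\<lambda>v. v) \<in> borel_measurable \<rho>" if "sphere_prob \<rho>" for \<rho> :: "(real ^ 'n) measure"
    by (rule sphere_prob_measurable[OF that]) auto
  have lim: "(\<lambda>k. \<integral>v. max 0 (1 - real k * infdist v C) \<partial>\<rho>) \<longlonglongrightarrow> measure (E \<rho>) C"
    if \<rho>: "sphere_prob \<rho>" and C: "closed C" "C \<noteq> {}" for \<rho> C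
  proof -
    interpret prob_space \<rho> by (rule sphere_prob_prob_space[OF \<rho>])
    have m: "measure (E \<rho>) C = (\<integral>v. indicator C v \<partial>\<rho>)"
    proof -
      have "measure (E \<rho>) C = (\<integral>v. indicator C v \<partial>E \<rho>)"
        using C by (simp add: E_def)
      also have "\<dots> = (\<integral>v. indicator C v \<partial>\<rho>)"
        unfolding E_def using C meas[OF \<rho>] by (subst integral_distr) auto
      finally show ?thesis .
    qed
    show ?thesis unfolding m
    proof (rule integral_dominated_convergence[where w="\<lambda>_. 1"])
      show "(\<lambda>v. indicat_real C v) \<in> borel_measurable \<rho>"
        using measurable_compose[OF meas[OF \<rho>], of "indicat_real C" borel] C by simp
      show "(\<lambda>v. max 0 (1 - real k * infdist v C)) \<in> borel_measurable \<rho>" for k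
        by (intro sphere_prob_measurable[OF \<rho>] continuous_intros)
      show "AE v in \<rho>. (\<lambda>k. max 0 (1 - real k * infdist v C)) \<longlonglongrightarrow> indicat_real C v"
      proof (rule AE_I2)
        fix v
        show "(\<lambda>k. max 0 (1 - real k * infdist v C)) \<longlonglongrightarrow> indicat_real C v"
        proof (cases "v \<in> C")
          case True
          then show ?thesis by simp
        next
          case False
          then have d: "infdist v C > 0"
            using C infdist_nonneg[of v C] by (metis in_closed_iff_infdist_zero less_eq_real_def)
          have "\<forall>\<^sub>F k in sequentially. max 0 (1 - real k * infdist v C) = 0"
          proof (rule eventually_sequentiallyI[of "nat \<lceil>1 / infdist v C\<rceil>"])
            fix k assume "k \<ge> nat \<lceil>1 / infdist v C\<rceil>"
            then have "real k \<ge> 1 / infdist v C" by linarith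
            then show "max 0 (1 - real k * infdist v C) = 0" using d by (simp add: field_simps)
          qed
          then show ?thesis using False by (simp add: tendsto_eventually)
        qed
      qed
      show "AE v in \<rho>. norm (max 0 (1 - real k * infdist v C)) \<le> 1" for k
        by (auto simp: infdist_nonneg)
    qed simp
  qed
  have Eeq: "E \<mu> = E \<nu>"
  proof (rule measure_eqI_generator_eq[where E="Collect closed" and \<Omega>=UNIV and A="\<lambda>_. UNIV"])
    fix C :: "(real ^ 'n) set" assume "C \<in> Collect closed"
    then have C: "closed C" by simp
    have "measure (E \<mu>) C = measure (E \<nu>) C"
    proof (cases "C = {}")
      case False
      have "(\<integral>v. max 0 (1 - real k * infdist v C) \<partial>\<mu>) = (\<integral>v. max 0 (1 - real k * infdist v C) \<partial>\<nu>)" for k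
        by (intro eq continuous_intros)
      then show ?thesis
        using lim[OF \<mu> C False] lim[OF \<nu> C False] by (simp add: LIMSEQ_unique)
    qed simp
    moreover have "finite_measure (E \<rho>)" if "sphere_prob \<rho>" for \<rho>
      unfolding E_def using prob_space.prob_space_distr[OF sphere_prob_prob_space[OF that] meas[OF that]]
      by (simp add: prob_space.finite_measure)
    ultimately show "emeasure (E \<mu>) C = emeasure (E \<nu>) C"
      using \<mu> \<nu> by (simp add: finite_measure.emeasure_eq_measure)
  next
    have "finite_measure (E \<mu>)"
      unfolding E_def using prob_space.prob_space_distr[OF sphere_prob_prob_space[OF \<mu>] meas[OF \<mu>]]
      by (simp add: prob_space.finite_measure)
    then show "emeasure (E \<mu>) UNIV \<noteq> \<infinity>"
      by (simp add: finite_measure.emeasure_finite top.not_eq_extremum)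
  qed (auto simp: Int_stable_def E_def borel_eq_closed)
  show ?thesis
  proof (rule measure_eqI)
    fix A assume "A \<in> sets \<mu>"
    then have A: "A \<in> sets borel" "A \<subseteq> unit_sphere"
      by (auto simp: sphere_prob_sets[OF \<mu>] sets_sphere_borel)
    have *: "emeasure (E \<rho>) A = emeasure \<rho> A" if "sphere_prob \<rho>" for \<rho>
      unfolding E_def using A meas[OF that] sphere_prob_space[OF that]
      by (subst emeasure_distr) (auto intro!: arg_cong[where f="emeasure \<rho>"])
    show "emeasure \<mu> A = emeasure \<nu> A"
      using *[OF \<mu>] *[OF \<nu>] Eeq by simp
  qed (simp add: sphere_prob_sets \<mu> \<nu>)
qed

section \<open>Uniqueness: the hierarchy of moments\<close>

text \<open>Indexing the factors by a finite set, rather than by a list or a multiset, makes the two operations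
of the hierarchy simple: a factor is removed by \<open>I - {i}\<close> and added by \<open>insert m I\<close> with a fresh \<open>m\<close>.\<close>

definition monomial :: "nat set \<Rightarrow> (nat \<Rightarrow> real ^ 'n) \<Rightarrow> real ^ 'n \<Rightarrow> real" where
  "monomial I a v = (\<Prod>i\<in>I. a i \<bullet> v)"

lemma continuous_on_monomial [continuous_intros]: "continuous_on S (monomial I a)"
  unfolding monomial_def by (intro continuous_intros)

lemma abs_monomial_le_1:
  assumes "\<And>i. i \<in> I \<Longrightarrow> norm (a i) \<le> 1" "v \<in> unit_sphere"
  shows "\<bar>monomial I a v\<bar> \<le> 1"
  unfolding monomial_def abs_prod
proof (rule prod_le_1, safe)
  fix i assume "i \<in> I"
  then show "\<bar>a i \<bullet> v\<bar> \<le> 1"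
    using Cauchy_Schwarz_ineq2[of "a i" v] assms by fastforce
qed auto

lemma monomial_insert_fun_upd:
  assumes "finite I" "m \<notin> I"
  shows "monomial (insert m I) (a(m := w)) = (\<lambda>v. (w \<bullet> v) * monomial I a v)"
proof
  fix v
  have "(\<Prod>i\<in>I. (a(m := w)) i \<bullet> v) = (\<Prod>i\<in>I. a i \<bullet> v)"
    using assms by (intro prod.cong) auto
  then show "monomial (insert m I) (a(m := w)) v = (w \<bullet> v) * monomial I a v"
    using assms by (simp add: monomial_def)
qed

text \<open>On the sphere, \<open>x \<bullet> x - 1\<close> vanishes. Subtracting half of \<open>v \<bullet> g\<close> times it from \<open>\<phi>\<close>
therefore does not change \<open>\<phi>\<close> on the sphere, but it removes the normal part of the differential.\<close>

lemma has_sphere_grad_of_ambient: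
  fixes v g :: "real ^ 'n"
  assumes v: "v \<in> unit_sphere" and d: "(\<phi> has_derivative (\<lambda>h. g \<bullet> h)) (at v within unit_sphere)"
  shows "has_sphere_grad \<phi> (g - (v \<bullet> g) *\<^sub>R v) v"
  unfolding has_sphere_grad_def
proof
  have vv: "v \<bullet> v = 1" using v by (simp add: norm_eq_1)
  then show "v \<bullet> (g - (v \<bullet> g) *\<^sub>R v) = 0" by (simp add: inner_diff_right)
  have "((\<lambda>x. \<phi> x - (v \<bullet> g) / 2 * (x \<bullet> x - 1)) has_derivative
      (\<lambda>h. g \<bullet> h - (v \<bullet> g) / 2 * (v \<bullet> h + h \<bullet> v))) (at v within unit_sphere)"
    using d by (auto intro!: derivative_eq_intros)
  then have "(\<phi> has_derivative (\<lambda>h. g \<bullet> h - (v \<bullet> g) / 2 * (v \<bullet> h + h \<bullet> v))) (at v within unit_sphere)"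
    by (rule has_derivative_transform[rotated 2]) (use v in \<open>auto simp: norm_eq_1\<close>)
  also have "(\<lambda>h. g \<bullet> h - (v \<bullet> g) / 2 * (v \<bullet> h + h \<bullet> v)) = (\<lambda>h. (g - (v \<bullet> g) *\<^sub>R v) \<bullet> h)"
    by (simp add: fun_eq_iff inner_diff_left inner_commute[of _ v])
  finally show "(\<phi> has_derivative (\<lambda>h. (g - (v \<bullet> g) *\<^sub>R v) \<bullet> h)) (at v within unit_sphere)" .
qed

lemma has_sphere_grad_monomial:
  fixes v :: "real ^ 'n"
  assumes v: "v \<in> unit_sphere" and I: "finite I"
  shows "has_sphere_grad (monomial I a)
    ((\<Sum>i\<in>I. monomial (I - {i}) a v *\<^sub>R a i) - (card I * monomial I a v) *\<^sub>R v) v"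
proof -
  define g where "g = (\<Sum>i\<in>I. monomial (I - {i}) a v *\<^sub>R a i)"
  have "((\<lambda>x. \<Prod>i\<in>I. a i \<bullet> x) has_derivative (\<lambda>h. \<Sum>i\<in>I. (a i \<bullet> h) * (\<Prod>j\<in>I - {i}. a j \<bullet> v)))
      (at v within unit_sphere)"
    by (intro has_derivative_prod derivative_intros)
  then have "(monomial I a has_derivative (\<lambda>h. g \<bullet> h)) (at v within unit_sphere)"
    by (simp add: monomial_def[abs_def] g_def inner_sum_left mult.commute)
  moreover have "v \<bullet> g = card I * monomial I a v"
  proof -
    have "v \<bullet> g = (\<Sum>i\<in>I. monomial I a v)"
      unfolding g_def inner_sum_right
    proof (rule sum.cong)
      fix i assume "i \<in> I"
      then show "v \<bullet> monomial (I - {i}) a v *\<^sub>R a i = monomial I a v"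
        using I by (simp add: monomial_def prod.remove[of I i] inner_commute)
    qed simp
    then show ?thesis by simp
  qed
  ultimately show ?thesis
    using has_sphere_grad_of_ambient[OF v] g_def by metis
qed

lemma C1_sphere_monomial:
  assumes I: "finite I" shows "C1_sphere (monomial I a :: real ^ 'n \<Rightarrow> real)"
  unfolding C1_sphere_def
proof
  show "\<forall>v\<in>unit_sphere. \<exists>G. has_sphere_grad (monomial I a) G v"
    using has_sphere_grad_monomial[OF _ I] by blast
  have "continuous_on unit_sphere (\<lambda>v. (\<Sum>i\<in>I. monomial (I - {i}) a v *\<^sub>R a i) - (card I * monomial I a v) *\<^sub>R v)"
    by (intro continuous_intros)
  then show "continuous_on unit_sphere (sphere_grad (monomial I a))"
    by (rule continuous_on_eq) (rule sphere_grad_eq[OF _ has_sphere_grad_monomial[OF _ I], symmetric])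
qed

definition moment :: "(real ^ 'n) measure \<Rightarrow> nat set \<Rightarrow> (nat \<Rightarrow> real ^ 'n) \<Rightarrow> real" where
  "moment \<mu> I a = (\<integral>v. monomial I a v \<partial>\<mu>)"

lemma integrable_id_sphere: "sphere_prob \<mu> \<Longrightarrow> integrable \<mu> (\<lambda>v. v)"
  by (intro sphere_prob_integrable continuous_intros)

lemma integrable_monomial: "sphere_prob \<mu> \<Longrightarrow> integrable \<mu> (monomial I a)"
  by (intro sphere_prob_integrable continuous_intros)

lemma abs_moment_le_1:
  assumes "sphere_prob \<mu>" "\<And>i. i \<in> I \<Longrightarrow> norm (a i) \<le> 1"
  shows "\<bar>moment \<mu> I a\<bar> \<le> 1"
  unfolding moment_def using abs_monomial_le_1[of I a] assms(2)
  by (auto intro!: sphere_prob_integral_norm_le[OF assms(1) continuous_on_monomial, of _ _ 1, unfolded real_norm_def])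

lemma moment_singleton: "sphere_prob \<mu> \<Longrightarrow> moment \<mu> {i} a = a i \<bullet> mean_vector \<mu>"
  using integrable_id_sphere[of \<mu>] by (simp add: moment_def monomial_def mean_vector_def)

lemma moment_insert_diff:
  assumes \<mu>: "sphere_prob \<mu>" and I: "finite I" "m \<notin> I"
  shows "moment \<mu> (insert m I) (a(m := w - w')) = moment \<mu> (insert m I) (a(m := w)) - moment \<mu> (insert m I) (a(m := w'))"
proof -
  have "monomial (insert m I) (a(m := w - w')) =
      (\<lambda>v. monomial (insert m I) (a(m := w)) v - monomial (insert m I) (a(m := w')) v)"
    by (simp add: monomial_insert_fun_upd[OF I] inner_diff_left left_diff_distrib)
  then show ?thesis
    by (simp add: moment_def Bochner_Integration.integral_diff integrable_monomial[OF \<mu>])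
qed

lemma moment_insert_scale:
  assumes I: "finite I" "m \<notin> I"
  shows "moment \<mu> (insert m I) (a(m := c *\<^sub>R w)) = c * moment \<mu> (insert m I) (a(m := w))"
  unfolding moment_def by (simp add: monomial_insert_fun_upd[OF I] mult.assoc)

lemma abs_moment_insert_le:
  assumes \<mu>: "sphere_prob \<mu>" and I: "finite I" "m \<notin> I" and a: "\<And>i. i \<in> I \<Longrightarrow> norm (a i) \<le> 1"
  shows "\<bar>moment \<mu> (insert m I) (a(m := w))\<bar> \<le> norm w"
proof -
  have "\<bar>moment \<mu> (insert m I) (a(m := sgn w))\<bar> \<le> 1"
    by (rule abs_moment_le_1[OF \<mu>]) (use a in \<open>auto simp: norm_sgn\<close>)
  then have "norm w * \<bar>moment \<mu> (insert m I) (a(m := sgn w))\<bar> \<le> norm w"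
    by (simp add: mult_left_le)
  moreover have "norm w *\<^sub>R sgn w = w" by (cases "w = 0") (simp_all add: sgn_div_norm)
  ultimately show ?thesis
    using moment_insert_scale[OF I, of \<mu> a "norm w" "sgn w"] by (simp add: abs_mult)
qed

lemma alignment_solution_sphere_prob: "alignment_solution \<mu>0 f \<Longrightarrow> t \<ge> 0 \<Longrightarrow> sphere_prob (f t)"
  by (simp add: alignment_solution_def)

lemma alignment_solution_weak_form:
  assumes "alignment_solution \<mu>0 f" "t \<ge> 0" "C1_sphere \<phi>"
  shows "((\<lambda>s. \<integral>v. \<phi> v \<partial>f s) has_real_derivative (\<integral>v. mean_vector (f t) \<bullet> sphere_grad \<phi> v \<partial>f t))
      (at t within {0..})"
proof -
  have "(\<forall>t\<ge>0. \<forall>\<phi>. C1_sphere \<phi> \<longrightarrow>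
        ((\<lambda>s. \<integral>v. \<phi> v \<partial>f s) has_real_derivative
           (\<integral>v. mean_vector (f t) \<bullet> sphere_grad \<phi> v \<partial>f t)) (at t within {0..}))"
    using assms(1) unfolding alignment_solution_def by (elim conjE)
  then show ?thesis using assms(2,3) by iprover
qed

text \<open>The hierarchy of moments. The first part comes from the ambient gradient of the monomial, the second
one from the normal part that the projection to the tangent space subtracts.\<close>

lemma moment_has_derivative:
  fixes f :: "real \<Rightarrow> (real ^ 'n) measure"
  assumes f: "alignment_solution \<mu>0 f" and t: "t \<ge> 0" and I: "finite I" "m \<notin> I"
  defines "J \<equiv> mean_vector (f t)"
  shows "((\<lambda>s. moment (f s) I a) has_real_derivative
    (\<Sum>i\<in>I. (J \<bullet> a i) * moment (f t) (I - {i}) a) - card I * moment (f t) (insert m I) (a(m := J)))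
    (at t within {0..})"
proof -
  have p: "sphere_prob (f t)" by (rule alignment_solution_sphere_prob[OF f t])
  have "(\<integral>v. J \<bullet> sphere_grad (monomial I a) v \<partial>f t) =
     (\<integral>v. (\<Sum>i\<in>I. (J \<bullet> a i) * monomial (I - {i}) a v) - card I * monomial (insert m I) (a(m := J)) v \<partial>f t)"
  proof (rule Bochner_Integration.integral_cong)
    fix v assume "v \<in> space (f t)"
    then have v: "v \<in> unit_sphere" by (simp add: sphere_prob_space[OF p])
    show "J \<bullet> sphere_grad (monomial I a) v =
        (\<Sum>i\<in>I. (J \<bullet> a i) * monomial (I - {i}) a v) - card I * monomial (insert m I) (a(m := J)) v"
      unfolding sphere_grad_eq[OF v has_sphere_grad_monomial[OF v I(1)]] monomial_insert_fun_upd[OF I]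
      by (simp add: inner_diff_right inner_sum_right mult.commute)
  qed simp
  also have "\<dots> = (\<Sum>i\<in>I. (J \<bullet> a i) * moment (f t) (I - {i}) a) - card I * moment (f t) (insert m I) (a(m := J))"
    by (simp add: moment_def Bochner_Integration.integral_diff Bochner_Integration.integral_sum
        integrable_monomial[OF p])
  finally have *: "(\<integral>v. J \<bullet> sphere_grad (monomial I a) v \<partial>f t) = \<dots>" .
  have "((\<lambda>s. moment (f s) I a) has_real_derivative (\<integral>v. J \<bullet> sphere_grad (monomial I a) v \<partial>f t))
      (at t within {0..})"
    unfolding J_def moment_def by (rule alignment_solution_weak_form[OF f t C1_sphere_monomial[OF I(1)]])
  then show ?thesis unfolding * .
qed

text \<open>This inequality says that the bound in \<open>moment_hierarchy_bound\<close> reproduces itself when the hierarchy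
is integrated once.\<close>

lemma mult_choose_Suc_le:
  "real k * real ((Suc k + N) choose N) \<le> real (Suc N) * real ((k + Suc N) choose Suc N)"
proof -
  have "Suc N * (Suc (N + k) choose Suc N) = Suc k * (Suc (N + k) choose N)"
    by (rule Suc_times_binomial_add)
  then have "real (Suc N) * real (Suc (N + k) choose Suc N) = real (Suc k) * real (Suc (N + k) choose N)"
    by (metis of_nat_mult)
  moreover have "real k * real (Suc (N + k) choose N) \<le> real (Suc k) * real (Suc (N + k) choose N)"
    by (rule mult_right_mono) auto
  moreover have "Suc k + N = Suc (N + k)" "k + Suc N = Suc (N + k)" by auto
  ultimately show ?thesis
    by metis
qed

lemma norm_le_if_unit_inner_le:
  fixes x :: "'a::real_inner"
  assumes "\<And>u. norm u \<le> 1 \<Longrightarrow> \<bar>u \<bullet> x\<bar> \<le> B"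
  shows "norm x \<le> B"
proof -
  have "sgn x \<bullet> x = norm x"
    by (cases "x = 0") (simp_all add: sgn_div_norm power2_norm_eq_inner[symmetric] power2_eq_square)
  moreover have "norm (sgn x) \<le> 1" by (simp add: norm_sgn)
  ultimately show ?thesis using assms[of "sgn x"] by simp
qed

text \<open>By induction on \<open>N\<close>, the number of times that the hierarchy has been integrated. For \<open>N = 0\<close> both
moments lie in \<open>[-1, 1]\<close>. For the step, let \<open>b\<close> bound the differences of all moments of degree at most
\<open>k + 1\<close>. It bounds in particular the difference of the means, which are moments of degree \<open>1\<close>. So each of the
\<open>k\<close> summands in the first part of the hierarchy, and the moment in the second part, differ by at most \<open>2 b\<close>,
and the derivatives differ by at most \<open>4 k b\<close>.\<close>

lemma moment_hierarchy_bound: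
  fixes f f' :: "real \<Rightarrow> (real ^ 'n) measure"
  assumes f: "alignment_solution \<mu>0 f" and f': "alignment_solution \<nu>0 f'" and t0: "t0 \<ge> 0"
    and eq0: "\<And>I a. finite I \<Longrightarrow> moment (f t0) I a = moment (f' t0) I a"
  shows "t \<ge> t0 \<Longrightarrow> finite I \<Longrightarrow> (\<And>i. i \<in> I \<Longrightarrow> norm (a i) \<le> 1) \<Longrightarrow>
    \<bar>moment (f t) I a - moment (f' t) I a\<bar> \<le> 2 * (4 * (t - t0)) ^ N * real ((card I + N) choose N)"
proof (induction N arbitrary: t I a)
  case 0
  then have "sphere_prob (f t)" "sphere_prob (f' t)"
    using f f' t0 by (auto simp: alignment_solution_def)
  then show ?case
    using abs_moment_le_1[of "f t" I a] abs_moment_le_1[of "f' t" I a] 0(3) by simp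
next
  case (Suc N)
  define k where "k = card I"
  obtain m where m: "m \<notin> I" using Suc.prems(2) ex_new_if_finite infinite_UNIV_nat by blast
  \<comment> \<open>the induction hypothesis for degree \<open>k + 1\<close>, which dominates those for \<open>1\<close> and \<open>k - 1\<close>\<close>
  define b where "b s = 2 * (4 * (s - t0)) ^ N * real ((Suc k + N) choose N)" for s
  define J where "J s = mean_vector (f s)" for s
  define J' where "J' s = mean_vector (f' s)" for s
  define d where "d s = ((\<Sum>i\<in>I. (J s \<bullet> a i) * moment (f s) (I - {i}) a) - k * moment (f s) (insert m I) (a(m := J s)))
    - ((\<Sum>i\<in>I. (J' s \<bullet> a i) * moment (f' s) (I - {i}) a) - k * moment (f' s) (insert m I) (a(m := J' s)))" for s
  have bound: "\<bar>d s\<bar> \<le> 4 * k * b s" if s: "s \<ge> t0" for s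
  proof -
    have p: "sphere_prob (f s)" and p': "sphere_prob (f' s)"
      using f f' t0 s by (auto simp: alignment_solution_def)
    have IH: "\<bar>moment (f s) K c - moment (f' s) K c\<bar> \<le> b s"
      if "finite K" "\<And>i. i \<in> K \<Longrightarrow> norm (c i) \<le> 1" "card K \<le> Suc k" for K c
    proof -
      have "\<bar>moment (f s) K c - moment (f' s) K c\<bar> \<le> 2 * (4 * (s - t0)) ^ N * real ((card K + N) choose N)"
        using Suc.IH[OF s that(1), of c] that(2) by blast
      also have "\<dots> \<le> b s"
        unfolding b_def using s that(3) by (intro mult_left_mono) (auto intro!: binomial_right_mono)
      finally show ?thesis .
    qed
    have JJ: "norm (J s - J' s) \<le> b s"
    proof (rule norm_le_if_unit_inner_le)
      fix u :: "real ^ 'n" assume "norm u \<le> 1"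
      then show "\<bar>u \<bullet> (J s - J' s)\<bar> \<le> b s"
        using IH[of "{m}" "\<lambda>_. u"] by (simp add: moment_singleton p p' J_def J'_def inner_diff_right)
    qed
    have J'1: "norm (J' s) \<le> 1" unfolding J'_def by (rule norm_mean_vector_le_1[OF p'])
    have b0: "b s \<ge> 0" using JJ norm_ge_zero order_trans by blast
    have 1: "\<bar>(J s \<bullet> a i) * moment (f s) (I - {i}) a - (J' s \<bullet> a i) * moment (f' s) (I - {i}) a\<bar> \<le> 2 * b s"
      if i: "i \<in> I" for i
    proof -
      have "(J s \<bullet> a i) * moment (f s) (I - {i}) a - (J' s \<bullet> a i) * moment (f' s) (I - {i}) a
        = ((J s - J' s) \<bullet> a i) * moment (f s) (I - {i}) a
          + (J' s \<bullet> a i) * (moment (f s) (I - {i}) a - moment (f' s) (I - {i}) a)"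
        by (simp add: inner_diff_left algebra_simps)
      moreover have "\<bar>((J s - J' s) \<bullet> a i) * moment (f s) (I - {i}) a\<bar> \<le> b s * 1"
        unfolding abs_mult
      proof (rule mult_mono)
        show "\<bar>(J s - J' s) \<bullet> a i\<bar> \<le> b s"
          using Cauchy_Schwarz_ineq2[of "J s - J' s" "a i"] JJ Suc.prems(3)[OF i] b0
          by (meson mult_left_le norm_ge_zero order_trans)
        show "\<bar>moment (f s) (I - {i}) a\<bar> \<le> 1" by (rule abs_moment_le_1[OF p]) (use Suc.prems(3) in auto)
      qed (use b0 in auto)
      moreover have "\<bar>(J' s \<bullet> a i) * (moment (f s) (I - {i}) a - moment (f' s) (I - {i}) a)\<bar> \<le> 1 * b s"
        unfolding abs_mult
      proof (rule mult_mono)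
        show "\<bar>J' s \<bullet> a i\<bar> \<le> 1"
          using Cauchy_Schwarz_ineq2[of "J' s" "a i"] J'1 Suc.prems(3)[OF i]
          by (meson mult_le_one norm_ge_zero order_trans)
        show "\<bar>moment (f s) (I - {i}) a - moment (f' s) (I - {i}) a\<bar> \<le> b s"
          by (rule IH) (use Suc.prems i in \<open>auto simp: k_def\<close>)
      qed (use b0 in auto)
      ultimately show ?thesis by linarith
    qed
    have 2: "\<bar>moment (f s) (insert m I) (a(m := J s)) - moment (f' s) (insert m I) (a(m := J' s))\<bar> \<le> 2 * b s"
    proof -
      have "moment (f s) (insert m I) (a(m := J s)) - moment (f' s) (insert m I) (a(m := J' s))
        = moment (f s) (insert m I) (a(m := J s - J' s))
          + (moment (f s) (insert m I) (a(m := J' s)) - moment (f' s) (insert m I) (a(m := J' s)))"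
        by (simp add: moment_insert_diff[OF p Suc.prems(2) m])
      moreover have "\<bar>moment (f s) (insert m I) (a(m := J s - J' s))\<bar> \<le> b s"
        using abs_moment_insert_le[OF p Suc.prems(2) m, of a "J s - J' s"] Suc.prems(3) JJ by fastforce
      moreover have "\<bar>moment (f s) (insert m I) (a(m := J' s)) - moment (f' s) (insert m I) (a(m := J' s))\<bar> \<le> b s"
        by (rule IH) (use Suc.prems m J'1 in \<open>auto simp: k_def\<close>)
      ultimately show ?thesis by linarith
    qed
    have "d s = (\<Sum>i\<in>I. (J s \<bullet> a i) * moment (f s) (I - {i}) a - (J' s \<bullet> a i) * moment (f' s) (I - {i}) a)
      - k * (moment (f s) (insert m I) (a(m := J s)) - moment (f' s) (insert m I) (a(m := J' s)))"
      unfolding d_def by (simp add: sum_subtractf algebra_simps)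
    also have "\<bar>\<dots>\<bar> \<le> (\<Sum>i\<in>I. 2 * b s) + \<bar>real k\<bar> * (2 * b s)"
      by (rule order_trans[OF abs_triangle_ineq4 add_mono[OF order_trans[OF sum_abs sum_mono[OF 1]]]],
          assumption, subst abs_mult, rule mult_left_mono[OF 2 abs_ge_zero])
    also have "\<dots> = 4 * k * b s" by (simp add: k_def)
    finally show ?thesis .
  qed
  define B where "B s = 2 * (4 * (s - t0)) ^ Suc N * real ((k + Suc N) choose Suc N)" for s
  define B' where "B' s = 8 * real (Suc N) * (4 * (s - t0)) ^ N * real ((k + Suc N) choose Suc N)" for s
  have B: "(B has_real_derivative B' s) (at s)" for s
    unfolding B_def B'_def by (rule derivative_eq_intros refl | simp)+
  have bB: "4 * k * b s \<le> B' s" if "s \<ge> t0" for s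
  proof -
    have "8 * (4 * (s - t0)) ^ N * (real k * real ((Suc k + N) choose N))
      \<le> 8 * (4 * (s - t0)) ^ N * (real (Suc N) * real ((k + Suc N) choose Suc N))"
      by (intro mult_left_mono mult_choose_Suc_le) (use that in auto)
    moreover have "4 * k * b s = 8 * (4 * (s - t0)) ^ N * (real k * real ((Suc k + N) choose N))"
      unfolding b_def by (simp del: add_Suc)
    moreover have "B' s = 8 * (4 * (s - t0)) ^ N * (real (Suc N) * real ((k + Suc N) choose Suc N))"
      unfolding B'_def by (simp only: mult_ac)
    ultimately show ?thesis by (simp only:)
  qed
  define D where "D s = moment (f s) I a - moment (f' s) I a" for s
  have D: "(D has_real_derivative d s) (at s within {0..})" if "s \<ge> 0" for s
    unfolding D_def d_def J_def J'_def k_def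
    by (intro DERIV_diff moment_has_derivative[OF f that Suc.prems(2) m] moment_has_derivative[OF f' that Suc.prems(2) m])
  show ?case
  proof (cases "t = t0")
    case True
    then show ?thesis using eq0[OF Suc.prems(2)] by simp
  next
    case False
    then have "t0 < t" using Suc.prems by simp
    then have "norm (D t - D t0) \<le> B t - B t0"
    proof (rule differentiable_bound_general)
      show "continuous_on {t0..t} D"
        using t0 by (intro DERIV_continuous_on[of _ _ d] DERIV_subset[OF D]) auto
      show "continuous_on {t0..t} B"
        using B by (auto intro!: continuous_at_imp_continuous_on DERIV_isCont)
      fix s assume s: "t0 < s" "s < t"
      have "at s within {0..} = at s"
        using s t0 by (intro at_within_interior) auto
      then show "(D has_vector_derivative d s) (at s)"
        using D[of s] s t0 by (simp add: has_real_derivative_iff_has_vector_derivative)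
      show "(B has_vector_derivative B' s) (at s)"
        using B by (simp add: has_real_derivative_iff_has_vector_derivative)
      show "norm (d s) \<le> B' s"
        using bound[of s] bB[of s] s by simp
    qed
    moreover have "D t0 = 0" "B t0 = 0"
      using eq0[OF Suc.prems(2)] by (auto simp: D_def B_def)
    ultimately show ?thesis by (simp add: D_def B_def k_def)
  qed
qed

text \<open>As \<open>k + N choose N \<le> 2 ^ (k + N)\<close>, the bound is geometric with ratio \<open>8 (t - t0) \<le> 1 / 2\<close>.\<close>

lemma moments_agree_short_time:
  fixes f f' :: "real \<Rightarrow> (real ^ 'n) measure"
  assumes f: "alignment_solution \<mu>0 f" and f': "alignment_solution \<nu>0 f'" and t0: "t0 \<ge> 0"
    and eq0: "\<And>I a. finite I \<Longrightarrow> moment (f t0) I a = moment (f' t0) I a"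
    and t: "t0 \<le> t" "t \<le> t0 + 1 / 16" and I: "finite I" and a: "\<And>i. i \<in> I \<Longrightarrow> norm (a i) \<le> 1"
  shows "moment (f t) I a = moment (f' t) I a"
proof -
  define x where "x = \<bar>moment (f t) I a - moment (f' t) I a\<bar>"
  have bound: "x \<le> 2 * 2 ^ card I * (1 / 2) ^ N" for N
  proof -
    have "x \<le> 2 * (4 * (t - t0)) ^ N * real ((card I + N) choose N)"
      unfolding x_def by (rule moment_hierarchy_bound[OF f f' t0 eq0 t(1) I a])
    also have "\<dots> \<le> 2 * (1 / 4) ^ N * 2 ^ (card I + N)"
    proof (intro mult_mono power_mono)
      show "real ((card I + N) choose N) \<le> 2 ^ (card I + N)"
        using binomial_le_pow2 by (metis of_nat_le_iff of_nat_numeral of_nat_power)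
    qed (use t in auto)
    also have "\<dots> = 2 * 2 ^ card I * (1 / 2) ^ N"
      by (simp add: power_add field_simps flip: power_mult_distrib)
    finally show ?thesis .
  qed
  have "(\<lambda>N. 2 * 2 ^ card I * (1 / 2) ^ N :: real) \<longlonglongrightarrow> 2 * 2 ^ card I * 0"
    by (intro tendsto_intros) auto
  then have "x \<le> 2 * 2 ^ card I * 0"
    by (rule LIMSEQ_le_const) (use bound in blast)
  then show ?thesis by (simp add: x_def)
qed

lemma monomial_sgn: "monomial I a v = (\<Prod>i\<in>I. norm (a i)) * monomial I (\<lambda>i. sgn (a i)) v"
proof -
  have "a i \<bullet> v = norm (a i) * (sgn (a i) \<bullet> v)" for i
    by (cases "a i = 0") (simp_all add: sgn_div_norm)
  then show ?thesis by (simp add: monomial_def flip: prod.distrib)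
qed

lemma moments_agree:
  fixes f f' :: "real \<Rightarrow> (real ^ 'n) measure"
  assumes f: "alignment_solution \<mu>0 f" and f': "alignment_solution \<mu>0 f'"
    and t: "t \<ge> 0" and I: "finite I"
  shows "moment (f t) I a = moment (f' t) I a"
proof -
  have scale: "moment \<mu> I a = (\<Prod>i\<in>I. norm (a i)) * moment \<mu> I (\<lambda>i. sgn (a i))"
    for \<mu> I and a :: "nat \<Rightarrow> real ^ 'n"
    unfolding moment_def by (subst monomial_sgn[abs_def]) simp
  have "\<forall>t I a. 0 \<le> t \<and> t \<le> real n / 16 \<and> finite I \<longrightarrow> moment (f t) I a = moment (f' t) I a" for n
  proof (induction n)
    case 0
    then show ?case using f f' by (auto simp: alignment_solution_def)
  next
    case (Suc n)
    show ?case
    proof (intro allI impI, elim conjE)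
      fix t and I :: "nat set" and a :: "nat \<Rightarrow> real ^ 'n" assume t: "0 \<le> t" "t \<le> real (Suc n) / 16" and I: "finite I"
      \<comment> \<open>the last time that the induction hypothesis covers, but not after \<open>t\<close>\<close>
      define t0 where "t0 = min t (real n / 16)"
      have "moment (f t) I (\<lambda>i. sgn (a i)) = moment (f' t) I (\<lambda>i. sgn (a i))"
        by (rule moments_agree_short_time[OF f f', of t0])
           (use t I Suc in \<open>auto simp: t0_def norm_sgn min_def field_simps\<close>)
      then show "moment (f t) I a = moment (f' t) I a"
        by (simp add: scale[of _ I a])
    qed
  qed
  from this[of "nat \<lceil>16 * t\<rceil>"] t I show ?thesis
    by (auto simp: field_simps)
qed

text \<open>The continuous functions whose products with all monomials have the same integral for both measures
form a set \<open>K\<close> that is stable under multiplication by linear functions, hence by polynomials. It contains \<open>1\<close>, so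
all polynomials have the same integrals, and polynomials are uniformly dense.\<close>

lemma sphere_prob_eq_if_moments_eq:
  fixes \<mu> \<nu> :: "(real ^ 'n) measure"
  assumes \<mu>: "sphere_prob \<mu>" and \<nu>: "sphere_prob \<nu>"
    and eq: "\<And>I a. finite I \<Longrightarrow> moment \<mu> I a = moment \<nu> I a"
  shows "\<mu> = \<nu>"
proof (rule sphere_prob_eqI[OF \<mu> \<nu>])
  define K where "K = {q :: real ^ 'n \<Rightarrow> real. continuous_on unit_sphere q \<and>
    (\<forall>I a. finite I \<longrightarrow> (\<integral>v. q v * monomial I a v \<partial>\<mu>) = (\<integral>v. q v * monomial I a v \<partial>\<nu>))}"
  have mult_K: "(\<lambda>v. q v * g v) \<in> K" if "real_polynomial_function g" "q \<in> K" for g q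
    using that
  proof (induction g arbitrary: q rule: real_polynomial_function.induct)
    case (linear g)
    define c where "c = adjoint g 1"
    have g: "g v = c \<bullet> v" for v
      using adjoint_works[OF bounded_linear.linear[OF linear(1)], of v 1] by (simp add: c_def inner_commute)
    show ?case unfolding K_def
    proof (intro CollectI conjI allI impI)
      show "continuous_on unit_sphere (\<lambda>v. q v * g v)"
        using linear(2) by (auto simp: g K_def intro!: continuous_intros)
      fix I :: "nat set" and a :: "nat \<Rightarrow> real ^ 'n" assume I: "finite I"
      obtain m where m: "m \<notin> I" using I ex_new_if_finite infinite_UNIV_nat by blast
      have *: "q v * g v * monomial I a v = q v * monomial (insert m I) (a(m := c)) v" for v
        by (simp add: monomial_insert_fun_upd[OF I m] g)
      show "(\<integral>v. q v * g v * monomial I a v \<partial>\<mu>) = (\<integral>v. q v * g v * monomial I a v \<partial>\<nu>)"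
        unfolding * using linear(2) I by (simp add: K_def)
    qed
  next
    case (const c)
    then show ?case by (auto simp: K_def mult_ac intro!: continuous_intros)
  next
    case (add g h)
    have "(\<lambda>v. q v * g v) \<in> K" "(\<lambda>v. q v * h v) \<in> K" using add by auto
    moreover have "(\<lambda>v. p v + r v) \<in> K" if p: "p \<in> K" and r: "r \<in> K" for p r
    proof -
      have "(\<integral>v. (p v + r v) * monomial I a v \<partial>\<rho>) = (\<integral>v. p v * monomial I a v \<partial>\<rho>) + (\<integral>v. r v * monomial I a v \<partial>\<rho>)"
        if \<rho>: "sphere_prob \<rho>" for \<rho> I a
        unfolding distrib_right using p r
        by (intro Bochner_Integration.integral_add sphere_prob_integrable[OF \<rho>] continuous_intros)
          (simp_all add: K_def)
      then show ?thesis
        using p r \<mu> \<nu> by (simp add: K_def continuous_on_add)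
    qed
    ultimately show ?case by (simp add: distrib_left)
  next
    case (mult g h)
    then have "(\<lambda>v. q v * g v * h v) \<in> K" by blast
    then show ?case by (simp add: mult.assoc)
  qed
  have "(\<lambda>v. 1) \<in> K" using eq by (auto simp: K_def moment_def)
  then have poly: "(\<integral>v. g v \<partial>\<mu>) = (\<integral>v. g v \<partial>\<nu>)" if "real_polynomial_function g" for g
    using mult_K[OF that, of "\<lambda>v. 1"] by (auto simp: K_def monomial_def dest!: spec[of _ "{}"])
  fix \<phi> :: "real ^ 'n \<Rightarrow> real" assume \<phi>: "continuous_on unit_sphere \<phi>"
  have "\<bar>(\<integral>v. \<phi> v \<partial>\<mu>) - (\<integral>v. \<phi> v \<partial>\<nu>)\<bar> \<le> 2 * e" if e: "e > 0" for e
  proof -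
    obtain g where g: "real_polynomial_function g" "\<And>v. v \<in> unit_sphere \<Longrightarrow> \<bar>\<phi> v - g v\<bar> < e"
      using Stone_Weierstrass_real_polynomial_function[OF compact_sphere \<phi> e] by blast
    have cg: "continuous_on unit_sphere g"
      using g(1) by (simp add: continuous_on_polymonial_function real_polynomial_function_eq)
    have *: "\<bar>(\<integral>v. \<phi> v \<partial>\<rho>) - (\<integral>v. g v \<partial>\<rho>)\<bar> \<le> e" if \<rho>: "sphere_prob \<rho>" for \<rho>
    proof -
      have "norm (\<integral>v. \<phi> v - g v \<partial>\<rho>) \<le> e"
        using g(2) by (intro sphere_prob_integral_norm_le[OF \<rho>] continuous_intros \<phi> cg) (auto intro: less_imp_le)
      then show ?thesis
        using sphere_prob_integrable[OF \<rho> \<phi>] sphere_prob_integrable[OF \<rho> cg] by simp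
    qed
    show ?thesis using *[OF \<mu>] *[OF \<nu>] poly[OF g(1)] by linarith
  qed
  then have "\<bar>(\<integral>v. \<phi> v \<partial>\<mu>) - (\<integral>v. \<phi> v \<partial>\<nu>)\<bar> \<le> e" if "e > 0" for e
    using that half_gt_zero[OF that] by fastforce
  then show "(\<integral>v. \<phi> v \<partial>\<mu>) = (\<integral>v. \<phi> v \<partial>\<nu>)"
    using dense_eq0_I[of "(\<integral>v. \<phi> v \<partial>\<mu>) - (\<integral>v. \<phi> v \<partial>\<nu>)"] by simp
qed

lemma alignment_solution_unique:
  fixes f f' :: "real \<Rightarrow> (real ^ 'n) measure"
  assumes "alignment_solution \<mu>0 f" "alignment_solution \<mu>0 f'" "t \<ge> 0"
  shows "f t = f' t"
  using assms by (intro sphere_prob_eq_if_moments_eq moments_agree) (auto simp: alignment_solution_def)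

section \<open>Integrals with a parameter and a scalar differential equation\<close>

text \<open>Dominated convergence for a real parameter.\<close>

lemma tendsto_integral_bounded:
  fixes F :: "real \<Rightarrow> 'a \<Rightarrow> 'b::{banach, second_countable_topology}"
  assumes "finite_measure M"
    and meas: "\<And>s. F s \<in> borel_measurable M" "l \<in> borel_measurable M"
    and lim: "\<And>v. v \<in> space M \<Longrightarrow> ((\<lambda>s. F s v) \<longlongrightarrow> l v) (at t within X)"
    and bd: "\<And>s v. s \<in> X \<Longrightarrow> v \<in> space M \<Longrightarrow> norm (F s v) \<le> B"
  shows "((\<lambda>s. \<integral>v. F s v \<partial>M) \<longlongrightarrow> (\<integral>v. l v \<partial>M)) (at t within X)"
  unfolding tendsto_at_iff_sequentially comp_def
proof (intro allI impI)
  interpret finite_measure M by fact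
  fix Y assume Y: "\<forall>i. Y i \<in> X - {t}" "Y \<longlonglongrightarrow> t"
  show "(\<lambda>i. \<integral>v. F (Y i) v \<partial>M) \<longlonglongrightarrow> (\<integral>v. l v \<partial>M)"
  proof (rule integral_dominated_convergence[where w="\<lambda>_. B"])
    show "AE v in M. (\<lambda>i. F (Y i) v) \<longlonglongrightarrow> l v"
      using lim Y unfolding tendsto_at_iff_sequentially comp_def by (intro AE_I2) blast
    show "AE v in M. norm (F (Y i) v) \<le> B" for i
      using bd Y by (intro AE_I2) blast
  qed (use meas in auto)
qed

text \<open>Differentiation under the integral: by the mean value theorem, the bound on \<open>F'\<close> also bounds the
difference quotients.\<close>

lemma has_real_derivative_integral_bounded:
  fixes F F' :: "real \<Rightarrow> 'a \<Rightarrow> real"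
  assumes "finite_measure M"
    and int: "\<And>s. integrable M (F s)" and meas: "F' t \<in> borel_measurable M"
    and deriv: "\<And>s v. v \<in> space M \<Longrightarrow> ((\<lambda>s. F s v) has_real_derivative F' s v) (at s)"
    and bd: "\<And>s v. v \<in> space M \<Longrightarrow> \<bar>F' s v\<bar> \<le> B"
  shows "((\<lambda>s. \<integral>v. F s v \<partial>M) has_real_derivative (\<integral>v. F' t v \<partial>M)) (at t)"
  unfolding has_field_derivative_iff
proof -
  have lim: "((\<lambda>y. \<integral>v. (F y v - F t v) / (y - t) \<partial>M) \<longlongrightarrow> (\<integral>v. F' t v \<partial>M)) (at t within UNIV)"
  proof (rule tendsto_integral_bounded[where B="max B 0"])
    show "finite_measure M" by fact
    show "F' t \<in> borel_measurable M" by fact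
    have F: "F s \<in> borel_measurable M" for s using int by auto
    show "(\<lambda>v. (F y v - F t v) / (y - t)) \<in> borel_measurable M" for y
      using F[of y] F[of t] by measurable
    show "((\<lambda>s. (F s v - F t v) / (s - t)) \<longlongrightarrow> F' t v) (at t)" if "v \<in> space M" for v
      using deriv[OF that, of t] by (simp add: has_field_derivative_iff)
    show "norm ((F s v - F t v) / (s - t)) \<le> max B 0" if v: "v \<in> space M" for s v
    proof -
      have "norm (F s v - F t v) \<le> B * norm (s - t)"
        by (rule field_differentiable_bound[where S=UNIV and f'="\<lambda>s. F' s v"]) (use deriv bd v in auto)
      also have "\<dots> \<le> max B 0 * norm (s - t)" by (rule mult_right_mono) auto
      finally show ?thesis by (cases "s = t") (auto simp: pos_divide_le_eq)
    qed
  qed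
  have "(\<integral>v. (F y v - F t v) / (y - t) \<partial>M) = ((\<integral>v. F y v \<partial>M) - (\<integral>v. F t v \<partial>M)) / (y - t)" for y
    using int by simp
  with lim show "((\<lambda>y. ((\<integral>v. F y v \<partial>M) - (\<integral>v. F t v \<partial>M)) / (y - t)) \<longlongrightarrow> (\<integral>v. F' t v \<partial>M)) (at t)"
    by (simp only:)
qed

text \<open>Separation of variables: \<open>s\<close> is the inverse of an antiderivative \<open>T\<close> of \<open>1 / K\<close>. Since \<open>K \<le> 1\<close>,
\<open>T\<close> grows with slope at least \<open>1\<close>, so it is a bijection of the line.\<close>

lemma autonomous_ode_solution:
  fixes K :: "real \<Rightarrow> real"
  assumes cont: "\<And>x. isCont K x" and pos: "\<And>x. 0 < K x" and le: "\<And>x. K x \<le> 1"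
  obtains s where "s 0 = 0" "\<And>t. (s has_real_derivative K (s t)) (at t)"
proof -
  have "\<exists>F. \<forall>x::real. - \<infinity> < ereal x \<longrightarrow> ereal x < \<infinity> \<longrightarrow> (F has_vector_derivative 1 / K x) (at x)"
    using cont pos by (intro einterval_antiderivative continuous_intros) (auto simp: less_imp_neq[symmetric])
  then obtain F where F: "\<And>x::real. (F has_real_derivative 1 / K x) (at x)"
    by (auto simp: has_real_derivative_iff_has_vector_derivative)
  \<comment> \<open>the time at which the solution reaches \<open>x\<close>\<close>
  define T where "T x = F x - F 0" for x
  have T: "(T has_real_derivative 1 / K x) (at x)" for x
    unfolding T_def by (auto intro!: derivative_eq_intros F)
  have slope: "y - x \<le> T y - T x" if "x \<le> y" for x y
  proof -
    have "T x - x \<le> T y - y"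
    proof (rule DERIV_nonneg_imp_nondecreasing[OF that])
      fix z
      have "((\<lambda>x. T x - x) has_real_derivative 1 / K z - 1) (at z)"
        by (auto intro!: derivative_eq_intros T)
      moreover have "0 \<le> 1 / K z - 1" using pos[of z] le[of z] by simp
      ultimately show "\<exists>D. ((\<lambda>x. T x - x) has_real_derivative D) (at z) \<and> 0 \<le> D" by blast
    qed
    then show ?thesis by simp
  qed
  have mono: "T x < T y" if "x < y" for x y using slope[of x y] that by simp
  have inj: "inj T" by (rule injI) (metis mono less_irrefl linorder_neqE_linordered_idom)
  have contT: "isCont T x" for x using T DERIV_isCont by blast
  have T0: "T 0 = 0" by (simp add: T_def)
  have "\<exists>x. T x = y" for y
  proof -
    have "T (- \<bar>y\<bar>) \<le> y" "y \<le> T \<bar>y\<bar>"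
      using slope[of "- \<bar>y\<bar>" 0] slope[of 0 "\<bar>y\<bar>"] T0 by auto
    then show ?thesis
      using IVT[of T "- \<bar>y\<bar>" y "\<bar>y\<bar>"] contT by auto
  qed
  then have surj: "surj T" by (metis surjI)
  define s where "s = inv T"
  have sT: "s (T x) = x" and Ts: "T (s y) = y" for x y
    using inj surj by (simp_all add: s_def surj_f_inv_f)
  have conts: "isCont s y" for y
    using isCont_inverse_function[of 1 "s y" s T] sT contT Ts by simp
  show ?thesis
  proof
    show "s 0 = 0" using sT[of 0] T0 by simp
    fix t
    have "(s has_real_derivative inverse (1 / K (s t))) (at t)"
      by (rule DERIV_inverse_function[where f=T and a="t - 1" and b="t + 1"])
        (use T Ts conts pos[of "s t"] in auto)
    then show "(s has_real_derivative K (s t)) (at t)" by simp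
  qed
qed

section \<open>The flow of a projected constant field\<close>

text \<open>On the null vectors \<open>(1, v)\<close> of Minkowski space, the Lorentz boost of rapidity \<open>s\<close> in direction \<open>e\<close> acts on
the coordinates \<open>(1, e \<bullet> v)\<close> as a hyperbolic rotation and fixes \<open>v - (e \<bullet> v) e\<close>. Dividing by the new time
coordinate \<open>cosh s + sinh s * (e \<bullet> v)\<close> gives a conformal map of the sphere.\<close>

definition boost :: "real ^ 'n \<Rightarrow> real \<Rightarrow> real ^ 'n \<Rightarrow> real ^ 'n" where
  "boost e s v = (1 / (cosh s + sinh s * (e \<bullet> v))) *\<^sub>R
     ((cosh s * (e \<bullet> v) + sinh s) *\<^sub>R e + (v - (e \<bullet> v) *\<^sub>R e))"

text \<open>The half-turn about the axis \<open>e\<close>: the identity on the axis and \<open>-1\<close> on its orthogonal complement. In any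
dimension, this one map suffices to force the mean of an invariant measure onto the axis.\<close>

definition axis_flip :: "real ^ 'n \<Rightarrow> real ^ 'n \<Rightarrow> real ^ 'n" where
  "axis_flip e v = (2 * (e \<bullet> v)) *\<^sub>R e - v"

lemma abs_inner_unit_le_1:
  fixes e v :: "real ^ 'n"
  assumes "e \<in> unit_sphere" "v \<in> unit_sphere"
  shows "\<bar>e \<bullet> v\<bar> \<le> 1"
  using Cauchy_Schwarz_ineq2[of e v] assms by simp

lemma boost_denominator_pos:
  fixes s x :: real
  assumes "\<bar>x\<bar> \<le> 1"
  shows "cosh s + sinh s * x > 0"
proof -
  have "\<bar>sinh s * x\<bar> \<le> \<bar>sinh s\<bar>"
    using assms by (simp add: abs_mult mult_left_le)
  moreover have "\<bar>sinh s\<bar> < cosh s"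
    by (simp add: abs_real_def sinh_less_cosh_real) (metis cosh_minus sinh_less_cosh_real sinh_minus)
  ultimately show ?thesis by linarith
qed

lemma axis_inner_boost:
  assumes e: "e \<in> unit_sphere"
  shows "e \<bullet> boost e s v = (cosh s * (e \<bullet> v) + sinh s) / (cosh s + sinh s * (e \<bullet> v))"
  using e by (simp add: boost_def inner_add_right inner_diff_right norm_eq_1)

lemma boost_in_sphere:
  fixes e v :: "real ^ 'n"
  assumes e: "e \<in> unit_sphere" and v: "v \<in> unit_sphere"
  shows "boost e s v \<in> unit_sphere"
proof -
  define x where "x = e \<bullet> v"
  define D where "D = cosh s + sinh s * x"
  have D: "D > 0" unfolding D_def x_def by (intro boost_denominator_pos abs_inner_unit_le_1 e v)
  have ee: "e \<bullet> e = 1" and vv: "v \<bullet> v = 1" using e v by (simp_all add: norm_eq_1)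
  define N where "N = (cosh s * x + sinh s) *\<^sub>R e + (v - x *\<^sub>R e)"
  have "N \<bullet> N = (cosh s * x + sinh s)\<^sup>2 + (1 - x\<^sup>2)"
    by (simp add: N_def inner_add_left inner_add_right inner_diff_left inner_diff_right ee vv
        inner_commute[of v e] x_def[symmetric] power2_eq_square algebra_simps)
  also have "\<dots> = D\<^sup>2"
    using cosh_square_eq[of s] unfolding D_def by (simp add: power2_eq_square algebra_simps)
  finally have "norm N = D" using D by (simp add: norm_eq_sqrt_inner)
  then show ?thesis
    using D by (simp add: boost_def N_def x_def D_def)
qed

lemma boost_0: "boost e 0 v = v"
  by (simp add: boost_def)

lemma continuous_on_boost:
  fixes e :: "real ^ 'n"
  assumes e: "e \<in> unit_sphere"
  shows "continuous_on unit_sphere (boost e s)"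
proof -
  have "cosh s + sinh s * (e \<bullet> v) \<noteq> 0" if "v \<in> unit_sphere" for v
    using boost_denominator_pos[OF abs_inner_unit_le_1[OF e that], of s] by simp
  then show ?thesis
    unfolding boost_def by (intro continuous_intros) auto
qed

lemma measurable_boost:
  "e \<in> unit_sphere \<Longrightarrow> boost e s \<in> measurable sphere_borel sphere_borel"
  by (intro measurable_sphere_borelI continuous_on_boost boost_in_sphere)

text \<open>Numerator \<open>N\<close> and denominator \<open>D\<close> of the boost satisfy the linear system \<open>N' = D e\<close>,
\<open>D' = e \<bullet> N\<close>; the quotient rule gives the projected field.\<close>

lemma boost_has_derivative:
  fixes e v :: "real ^ 'n"
  assumes e: "e \<in> unit_sphere" and v: "v \<in> unit_sphere"
  shows "((\<lambda>s. boost e s v) has_vector_derivative e - (e \<bullet> boost e s v) *\<^sub>R boost e s v) (at s)"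
proof -
  define x where "x = e \<bullet> v"
  define D where "D s = cosh s + sinh s * x" for s
  define N where "N s = (cosh s * x + sinh s) *\<^sub>R e + (v - x *\<^sub>R e)" for s
  have D: "D s > 0" unfolding D_def x_def by (intro boost_denominator_pos abs_inner_unit_le_1 e v)
  have b: "boost e s v = (1 / D s) *\<^sub>R N s" for s
    by (simp add: boost_def D_def N_def x_def)
  have D': "(D has_real_derivative (cosh s * x + sinh s)) (at s)"
    unfolding D_def by (auto intro!: derivative_eq_intros)
  have inv: "((\<lambda>s. 1 / D s) has_real_derivative - (cosh s * x + sinh s) / (D s * D s)) (at s)"
    using D by (auto intro!: derivative_eq_intros D')
  have "((\<lambda>s. cosh s * x + sinh s) has_real_derivative D s) (at s)"
    unfolding D_def by (auto intro!: derivative_eq_intros)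
  then have N': "(N has_vector_derivative (D s *\<^sub>R e)) (at s)"
    unfolding N_def D_def by (auto intro!: derivative_eq_intros simp: add.commute)
  have "((\<lambda>s. (1 / D s) *\<^sub>R N s) has_vector_derivative
      ((1 / D s) *\<^sub>R (D s *\<^sub>R e) + (- (cosh s * x + sinh s) / (D s * D s)) *\<^sub>R N s)) (at s)"
    by (rule has_vector_derivative_scaleR[OF inv N'])
  moreover have "e \<bullet> boost e s v = (cosh s * x + sinh s) / D s"
    by (simp add: axis_inner_boost[OF e] D_def x_def)
  then have "(1 / D s) *\<^sub>R (D s *\<^sub>R e) + (- (cosh s * x + sinh s) / (D s * D s)) *\<^sub>R N s
      = e - (e \<bullet> boost e s v) *\<^sub>R boost e s v"
    using D by (simp add: b scaleR_diff_left diff_divide_distrib add_divide_distrib scaleR_add_left)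
  ultimately show ?thesis
    unfolding b[abs_def, symmetric] by simp
qed

lemma axis_flip_in_sphere:
  fixes e v :: "real ^ 'n"
  assumes e: "e \<in> unit_sphere" and v: "v \<in> unit_sphere"
  shows "axis_flip e v \<in> unit_sphere"
proof -
  have "axis_flip e v \<bullet> axis_flip e v = v \<bullet> v + 4 * (e \<bullet> v)\<^sup>2 * (e \<bullet> e - 1)"
    by (simp add: axis_flip_def inner_diff_left inner_diff_right inner_commute[of v e] power2_eq_square algebra_simps)
  then show ?thesis using e v by (simp add: norm_eq_1)
qed

lemma bounded_linear_axis_flip: "bounded_linear (axis_flip e)"
  unfolding axis_flip_def
  by (intro bounded_linear_sub bounded_linear_ident bounded_linear_scaleR_const bounded_linear_const_mult
      bounded_linear_inner_right)

lemma measurable_axis_flip: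
  "e \<in> unit_sphere \<Longrightarrow> axis_flip e \<in> measurable sphere_borel sphere_borel"
  by (intro measurable_sphere_borelI axis_flip_in_sphere linear_continuous_on bounded_linear_axis_flip)

lemma boost_axis_flip:
  assumes e: "e \<in> unit_sphere"
  shows "boost e s (axis_flip e v) = axis_flip e (boost e s v)"
proof -
  define x where "x = e \<bullet> v"
  define D where "D = cosh s + sinh s * x"
  have ee: "e \<bullet> e = 1" using e by (simp add: norm_eq_1)
  have x: "e \<bullet> axis_flip e v = x"
    by (simp add: axis_flip_def inner_diff_right ee x_def)
  define y where "y = (cosh s * x + sinh s) / D"
  define w where "w = (1 / D) *\<^sub>R (v - x *\<^sub>R e)"
  have f: "axis_flip e v - x *\<^sub>R e = - (v - x *\<^sub>R e)"
    by (simp add: axis_flip_def x_def[symmetric] scaleR_2 flip: scaleR_scaleR)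
  have "boost e s (axis_flip e v) = y *\<^sub>R e - w"
    unfolding boost_def x D_def[symmetric] f w_def y_def
    by (simp only: scaleR_add_right scaleR_minus_right) simp
  moreover have "boost e s v = y *\<^sub>R e + w"
    unfolding boost_def x_def[symmetric] D_def[symmetric] w_def y_def by (simp add: scaleR_add_right)
  moreover have "e \<bullet> boost e s v = y"
    by (simp add: axis_inner_boost[OF e] x_def D_def y_def)
  ultimately show ?thesis
    by (simp add: axis_flip_def scaleR_2 flip: scaleR_scaleR)
qed

text \<open>The component along the axis increases along the flow. For the means this gives \<open>H s \<ge> H 0 > 0\<close>.\<close>

lemma axis_inner_le_axis_inner_boost:
  fixes e v :: "real ^ 'n"
  assumes e: "e \<in> unit_sphere" and v: "v \<in> unit_sphere" and s: "s \<ge> 0"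
  shows "e \<bullet> v \<le> e \<bullet> boost e s v"
proof -
  have x: "\<bar>e \<bullet> v\<bar> \<le> 1" by (rule abs_inner_unit_le_1[OF e v])
  have "sinh s * ((e \<bullet> v) * (e \<bullet> v)) \<le> sinh s * 1"
    using x s by (intro mult_left_mono) (auto simp: abs_square_le_1[unfolded power2_eq_square])
  then show ?thesis
    unfolding axis_inner_boost[OF e] using boost_denominator_pos[OF x, of s]
    by (simp add: pos_le_divide_eq algebra_simps)
qed

text \<open>Dividing numerator and denominator by \<open>cosh s\<close> leaves \<open>tanh s\<close>, which tends to \<open>1\<close>, and \<open>1 / cosh s\<close>,
which tends to \<open>0\<close>. The limit of the denominator is \<open>1 + e \<bullet> v\<close>, so \<open>v = - e\<close> has to be excluded.\<close>

lemma boost_tendsto_axis: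
  fixes e v :: "real ^ 'n"
  assumes e: "e \<in> unit_sphere" and v: "v \<in> unit_sphere" and ne: "e \<bullet> v \<noteq> -1"
  shows "((\<lambda>s. boost e s v) \<longlongrightarrow> e) at_top"
proof -
  define x where "x = e \<bullet> v"
  have x: "x > -1" using ne abs_inner_unit_le_1[OF e v] by (auto simp: x_def)
  have *: "boost e s v = (1 / (1 + tanh s * x)) *\<^sub>R ((x + tanh s) *\<^sub>R e + (1 / cosh s) *\<^sub>R (v - x *\<^sub>R e))" for s
  proof -
    have c: "cosh s \<noteq> 0" using cosh_real_nonzero by blast
    have p: "1 / (cosh s + sinh s * x) = (1 / (1 + tanh s * x)) * (1 / cosh s)"
      using c by (simp add: tanh_def field_simps)
    have q: "(1 / cosh s) *\<^sub>R ((cosh s * x + sinh s) *\<^sub>R e + (v - x *\<^sub>R e)) =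
        (x + tanh s) *\<^sub>R e + (1 / cosh s) *\<^sub>R (v - x *\<^sub>R e)"
      using c by (simp add: scaleR_add_right tanh_def add_divide_distrib)
    show ?thesis
      unfolding boost_def x_def[symmetric] p scaleR_scaleR[symmetric] q ..
  qed
  have "((\<lambda>s::real. 1 / cosh s) \<longlongrightarrow> 0) at_top"
    by (rule tendsto_divide_0[OF tendsto_const]) (intro filterlim_at_top_imp_at_infinity cosh_real_at_top)
  then have "((\<lambda>s. (1 / (1 + tanh s * x)) *\<^sub>R ((x + tanh s) *\<^sub>R e + (1 / cosh s) *\<^sub>R (v - x *\<^sub>R e)))
     \<longlongrightarrow> (1 / (1 + 1 * x)) *\<^sub>R ((x + 1) *\<^sub>R e + 0 *\<^sub>R (v - x *\<^sub>R e))) at_top"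
    using x by (intro tendsto_intros tanh_real_at_top) auto
  moreover have "(1 / (1 + 1 * x)) *\<^sub>R ((x + 1) *\<^sub>R e + 0 *\<^sub>R (v - x *\<^sub>R e)) = e"
    using x by (simp add: add.commute)
  ultimately show ?thesis unfolding * by simp
qed

section \<open>Solutions that are symmetric about an axis\<close>

lemma fixed_by_axis_flip: "axis_flip e m = m \<Longrightarrow> m = (e \<bullet> m) *\<^sub>R e"
proof -
  assume "axis_flip e m = m"
  then have "2 *\<^sub>R m = 2 *\<^sub>R ((e \<bullet> m) *\<^sub>R e)"
    by (simp add: axis_flip_def scaleR_2 algebra_simps flip: scaleR_scaleR)
  then show ?thesis by (simp only: scaleR_cancel_left) simp
qed

lemma sphere_prob_distr_boost:
  assumes "sphere_prob \<mu>" "e \<in> unit_sphere"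
  shows "sphere_prob (distr \<mu> sphere_borel (boost e s))"
proof -
  have "boost e s \<in> measurable \<mu> sphere_borel"
    using measurable_boost[OF assms(2)] sphere_prob_sets[OF assms(1)] by (simp cong: measurable_cong_sets)
  then show ?thesis
    using assms(1) by (simp add: sphere_prob_def prob_space.prob_space_distr)
qed

lemma integral_distr_sphere:
  fixes \<phi> :: "real ^ 'n \<Rightarrow> 'b::{banach, second_countable_topology}"
  assumes "sphere_prob \<mu>" "\<Phi> \<in> measurable sphere_borel sphere_borel" "continuous_on unit_sphere \<phi>"
  shows "(\<integral>v. \<phi> v \<partial>distr \<mu> sphere_borel \<Phi>) = (\<integral>v. \<phi> (\<Phi> v) \<partial>\<mu>)"
proof (rule integral_distr)
  show "\<Phi> \<in> measurable \<mu> sphere_borel"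
    using assms(2) sphere_prob_sets[OF assms(1)] by (simp cong: measurable_cong_sets)
qed (rule borel_measurable_sphere_borel[OF assms(3)])

lemma continuous_integral_boost:
  fixes e :: "real ^ 'n" and \<phi> :: "real ^ 'n \<Rightarrow> 'b::{banach, second_countable_topology}"
  assumes \<mu>: "sphere_prob \<mu>" and e: "e \<in> unit_sphere" and \<phi>: "continuous_on unit_sphere \<phi>"
  shows "isCont (\<lambda>s. \<integral>v. \<phi> (boost e s v) \<partial>\<mu>) s0"
  unfolding isCont_def
proof -
  obtain B where B: "\<And>v. v \<in> unit_sphere \<Longrightarrow> norm (\<phi> v) \<le> B"
    using continuous_on_sphere_bounded[OF \<phi>] by blast
  have c: "continuous_on unit_sphere (\<lambda>v. \<phi> (boost e s v))" for s
    by (rule continuous_on_compose2[OF \<phi> continuous_on_boost[OF e]]) (use boost_in_sphere[OF e] in auto)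
  show "((\<lambda>s. \<integral>v. \<phi> (boost e s v) \<partial>\<mu>) \<longlongrightarrow> (\<integral>v. \<phi> (boost e s0 v) \<partial>\<mu>)) (at s0)"
  proof (rule tendsto_integral_bounded[where B=B])
    show "finite_measure \<mu>"
      using sphere_prob_prob_space[OF \<mu>] by (simp add: prob_space.finite_measure)
    fix v assume "v \<in> space \<mu>"
    then have v: "v \<in> unit_sphere" by (simp add: sphere_prob_space[OF \<mu>])
    show "norm (\<phi> (boost e s v)) \<le> B" for s by (rule B[OF boost_in_sphere[OF e v]])
    have "((\<lambda>s. boost e s v) \<longlongrightarrow> boost e s0 v) (at s0)"
      using has_vector_derivative_continuous[OF boost_has_derivative[OF e v]] by (simp add: isCont_def)
    then show "((\<lambda>s. \<phi> (boost e s v)) \<longlongrightarrow> \<phi> (boost e s0 v)) (at s0)"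
      by (rule continuous_on_tendsto_compose[OF \<phi>]) (use boost_in_sphere[OF e v] in auto)
  qed (intro sphere_prob_measurable[OF \<mu>] c)+
qed

lemma C1_sphere_continuous:
  fixes \<phi> :: "real ^ 'n \<Rightarrow> real"
  assumes "C1_sphere \<phi>"
  shows "continuous_on unit_sphere \<phi>" "continuous_on unit_sphere (sphere_grad \<phi>)"
proof -
  show "continuous_on unit_sphere \<phi>"
    using assms unfolding C1_sphere_def has_sphere_grad_def continuous_on_eq_continuous_within
    by (blast intro: has_derivative_continuous)
  show "continuous_on unit_sphere (sphere_grad \<phi>)"
    using assms by (simp add: C1_sphere_def)
qed

text \<open>The gradient is tangent, so only the part \<open>e\<close> of the velocity \<open>e - (e \<bullet> b) b\<close> contributes.\<close>

lemma sphere_grad_along_boost: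
  fixes e v :: "real ^ 'n"
  assumes \<phi>: "C1_sphere \<phi>" and e: "e \<in> unit_sphere" and v: "v \<in> unit_sphere"
  shows "((\<lambda>s. \<phi> (boost e s v)) has_real_derivative e \<bullet> sphere_grad \<phi> (boost e s v)) (at s)"
proof -
  define b where "b = boost e s v"
  have b: "b \<in> unit_sphere" unfolding b_def by (rule boost_in_sphere[OF e v])
  define G where "G = sphere_grad \<phi> b"
  have G: "has_sphere_grad \<phi> G b"
    using \<phi> b sphere_grad_eq[OF b] unfolding C1_sphere_def G_def by metis
  have "((\<lambda>s. boost e s v) has_derivative (\<lambda>h. h *\<^sub>R (e - (e \<bullet> b) *\<^sub>R b))) (at s)"
    using boost_has_derivative[OF e v, of s] by (simp add: has_vector_derivative_def b_def)
  moreover have "(\<phi> has_derivative (\<lambda>h. G \<bullet> h)) (at (boost e s v) within range (\<lambda>s. boost e s v))"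
    using G boost_in_sphere[OF e v] unfolding has_sphere_grad_def b_def
    by (auto intro: has_derivative_subset)
  ultimately have "(\<phi> \<circ> (\<lambda>s. boost e s v) has_derivative (\<lambda>h. G \<bullet> h) \<circ> (\<lambda>h. h *\<^sub>R (e - (e \<bullet> b) *\<^sub>R b))) (at s)"
    by (rule diff_chain_within)
  moreover have "G \<bullet> (e - (e \<bullet> b) *\<^sub>R b) = e \<bullet> G"
    using G by (simp add: has_sphere_grad_def inner_diff_right inner_commute)
  ultimately show ?thesis
    unfolding has_field_derivative_def
    by (simp add: comp_def G_def b_def mult_commute_abs)
qed

lemma has_derivative_integral_boost:
  fixes e :: "real ^ 'n"
  assumes \<mu>: "sphere_prob \<mu>" and e: "e \<in> unit_sphere" and \<phi>: "C1_sphere \<phi>"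
  shows "((\<lambda>s. \<integral>v. \<phi> (boost e s v) \<partial>\<mu>) has_real_derivative
    (\<integral>v. e \<bullet> sphere_grad \<phi> (boost e s v) \<partial>\<mu>)) (at s)"
proof -
  note c\<phi> = C1_sphere_continuous(1)[OF \<phi>] and cG = C1_sphere_continuous(2)[OF \<phi>]
  obtain B where B: "\<And>v. v \<in> unit_sphere \<Longrightarrow> norm (sphere_grad \<phi> v) \<le> B"
    using continuous_on_sphere_bounded[OF cG] by blast
  show ?thesis
  proof (rule has_real_derivative_integral_bounded[where B=B])
    show "finite_measure \<mu>"
      using sphere_prob_prob_space[OF \<mu>] by (simp add: prob_space.finite_measure)
    show "integrable \<mu> (\<lambda>v. \<phi> (boost e s v))" for s
      by (rule sphere_prob_integrable[OF \<mu> continuous_on_compose2[OF c\<phi> continuous_on_boost[OF e]]])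
        (use boost_in_sphere[OF e] in auto)
    have "continuous_on unit_sphere (\<lambda>v. sphere_grad \<phi> (boost e s v))"
      by (rule continuous_on_compose2[OF cG continuous_on_boost[OF e]]) (use boost_in_sphere[OF e] in auto)
    then show "(\<lambda>v. e \<bullet> sphere_grad \<phi> (boost e s v)) \<in> borel_measurable \<mu>"
      by (intro sphere_prob_measurable[OF \<mu>] continuous_intros)
    fix v s assume "v \<in> space \<mu>"
    then have v: "v \<in> unit_sphere" by (simp add: sphere_prob_space[OF \<mu>])
    show "((\<lambda>s. \<phi> (boost e s v)) has_real_derivative e \<bullet> sphere_grad \<phi> (boost e s v)) (at s)"
      by (rule sphere_grad_along_boost[OF \<phi> e v])
    show "\<bar>e \<bullet> sphere_grad \<phi> (boost e s v)\<bar> \<le> B"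
      using Cauchy_Schwarz_ineq2[of e "sphere_grad \<phi> (boost e s v)"] e B[OF boost_in_sphere[OF e v], of s] by simp
  qed
qed

text \<open>The mean \<open>m s\<close> of the boosted measure is fixed by the half-turn, which commutes with the boost. Hence
\<open>m s = H s *\<^sub>R e\<close>, and in the clock \<open>s\<close> with \<open>s' = H s\<close> the flow of the constant field \<open>e\<close> becomes the flow of the
field of the means. The bounds \<open>H 0 \<le> H \<le> 1\<close> on \<open>[0, \<infinity>)\<close> give \<open>H 0 * t \<le> s t \<le> t\<close>.\<close>

lemma axisymmetric_solution:
  fixes e :: "real ^ 'n"
  assumes e: "e \<in> unit_sphere" and \<mu>: "sphere_prob \<mu>"
    and flip: "distr \<mu> sphere_borel (axis_flip e) = \<mu>" and pos: "0 < e \<bullet> mean_vector \<mu>"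
  obtains s where "\<And>t. t \<ge> 0 \<Longrightarrow> 0 \<le> s t \<and> s t \<le> t" "filterlim s at_top at_top"
    "alignment_solution \<mu> (\<lambda>t. distr \<mu> sphere_borel (boost e (s t)))"
proof -
  define m where "m s = (\<integral>v. boost e s v \<partial>\<mu>)" for s
  define H where "H s = e \<bullet> m s" for s
  have id: "continuous_on unit_sphere (\<lambda>v::real ^ 'n. v)" by (rule continuous_on_id)
  have intb: "integrable \<mu> (boost e s)" for s
    by (rule sphere_prob_integrable[OF \<mu> continuous_on_boost[OF e]])
  have m: "mean_vector (distr \<mu> sphere_borel (boost e s)) = m s" for s
    unfolding mean_vector_def m_def by (rule integral_distr_sphere[OF \<mu> measurable_boost[OF e] id])
  have mH: "m s = H s *\<^sub>R e" for s
  proof -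
    have "m s = (\<integral>v. boost e s v \<partial>distr \<mu> sphere_borel (axis_flip e))" by (simp add: flip m_def)
    also have "\<dots> = (\<integral>v. boost e s (axis_flip e v) \<partial>\<mu>)"
      by (rule integral_distr_sphere[OF \<mu> measurable_axis_flip[OF e] continuous_on_boost[OF e]])
    also have "\<dots> = axis_flip e (m s)"
      unfolding m_def boost_axis_flip[OF e] by (rule integral_bounded_linear[OF bounded_linear_axis_flip intb])
    finally show ?thesis unfolding H_def by (intro fixed_by_axis_flip) simp
  qed
  have contH: "isCont H s" for s
    unfolding H_def m_def by (intro continuous_intros continuous_integral_boost[OF \<mu> e id])
  have H0: "H 0 = e \<bullet> mean_vector \<mu>" by (simp add: H_def m_def boost_0 mean_vector_def)
  have Hi: "H s = (\<integral>v. e \<bullet> boost e s v \<partial>\<mu>)" for s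
    unfolding H_def m_def by (simp add: intb)
  have Hge: "H 0 \<le> H s" if "s \<ge> 0" for s
  proof -
    have i: "integrable \<mu> (\<lambda>v. e \<bullet> boost e s v)" for s using intb by simp
    show ?thesis unfolding Hi
      by (rule integral_mono[OF i i])
        (use axis_inner_le_axis_inner_boost[OF e _ that] in \<open>simp add: boost_0 sphere_prob_space[OF \<mu>]\<close>)
  qed
  have Hle: "H s \<le> 1" for s
  proof -
    have "norm (m s) \<le> 1" unfolding m[symmetric] by (intro norm_mean_vector_le_1 sphere_prob_distr_boost \<mu> e)
    then show ?thesis using e by (simp add: mH abs_le_iff)
  qed
  \<comment> \<open>positivity of \<open>H\<close> is known for \<open>s \<ge> 0\<close> only; the solution never sees the modification below \<open>0\<close>\<close>
  have contK: "isCont (\<lambda>s. H (max 0 s)) s" for s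
    by (rule isCont_o2[OF _ contH]) (intro continuous_intros)
  have K0: "0 < H (max 0 s)" for s using Hge[of "max 0 s"] H0 pos by simp
  obtain s where s0: "s 0 = 0" and s: "\<And>t. (s has_real_derivative H (max 0 (s t))) (at t)"
    using autonomous_ode_solution[OF contK K0 Hle] by blast
  have s_ge: "H 0 * t \<le> s t" and s_le: "s t \<le> t" if t: "t \<ge> 0" for t
  proof -
    have "s 0 - H 0 * 0 \<le> s t - H 0 * t"
      by (rule DERIV_nonneg_imp_nondecreasing[OF t])
        (auto intro!: exI derivative_eq_intros s simp: Hge)
    then show "H 0 * t \<le> s t" by (simp add: s0)
    have "0 - s 0 \<le> t - s t"
      by (rule DERIV_nonneg_imp_nondecreasing[OF t])
        (auto intro!: exI derivative_eq_intros s simp: Hle)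
    then show "s t \<le> t" by (simp add: s0)
  qed
  have s_nonneg: "0 \<le> s t" if "t \<ge> 0" for t
    using s_ge[OF that] mult_nonneg_nonneg[of "H 0" t] that pos H0 by linarith
  have lim: "filterlim s at_top at_top"
  proof (rule filterlim_at_top_mono)
    show "filterlim (\<lambda>t. H 0 * t) at_top at_top"
      using pos H0 by (intro filterlim_tendsto_pos_mult_at_top[OF tendsto_const _ filterlim_ident]) simp
    show "\<forall>\<^sub>F t in at_top. H 0 * t \<le> s t"
      using eventually_ge_at_top[of 0] by eventually_elim (rule s_ge)
  qed
  have "alignment_solution \<mu> (\<lambda>t. distr \<mu> sphere_borel (boost e (s t)))"
    unfolding alignment_solution_def
  proof (intro conjI allI impI)
    show "sphere_prob (distr \<mu> sphere_borel (boost e (s t)))" for t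
      by (rule sphere_prob_distr_boost[OF \<mu> e])
    have "boost e 0 = (\<lambda>v. v)" by (simp add: fun_eq_iff boost_0)
    then show "distr \<mu> sphere_borel (boost e (s 0)) = \<mu>"
      by (simp add: s0 distr_id2 sphere_prob_sets[OF \<mu>])
    have int: "(\<integral>v. \<phi> v \<partial>distr \<mu> sphere_borel (boost e s)) = (\<integral>v. \<phi> (boost e s v) \<partial>\<mu>)"
      if "continuous_on unit_sphere \<phi>" for \<phi> :: "real ^ 'n \<Rightarrow> real" and s
      by (rule integral_distr_sphere[OF \<mu> measurable_boost[OF e] that])
    fix t :: real assume t: "t \<ge> 0"
    show "sphere_weak_tendsto (\<lambda>t. distr \<mu> sphere_borel (boost e (s t)))
        (distr \<mu> sphere_borel (boost e (s t))) (at t within {0..})"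
      unfolding sphere_weak_tendsto_def
    proof (intro allI impI)
      fix \<phi> :: "real ^ 'n \<Rightarrow> real" assume \<phi>: "continuous_on unit_sphere \<phi>"
      have "(s \<longlongrightarrow> s t) (at t within {0..})"
        using DERIV_isCont[OF s[of t]] by (auto simp: isCont_def intro: tendsto_within_subset[of _ _ _ UNIV])
      then show "((\<lambda>t. \<integral>v. \<phi> v \<partial>distr \<mu> sphere_borel (boost e (s t))) \<longlongrightarrow>
          (\<integral>v. \<phi> v \<partial>distr \<mu> sphere_borel (boost e (s t)))) (at t within {0..})"
        unfolding int[OF \<phi>] by (rule isCont_tendsto_compose[OF continuous_integral_boost[OF \<mu> e \<phi>]])
    qed
    fix \<phi> :: "real ^ 'n \<Rightarrow> real" assume \<phi>: "C1_sphere \<phi>"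
    note c\<phi> = C1_sphere_continuous(1)[OF \<phi>] and cG = C1_sphere_continuous(2)[OF \<phi>]
    have "((\<lambda>t. \<integral>v. \<phi> (boost e (s t) v) \<partial>\<mu>) has_real_derivative
        (\<integral>v. e \<bullet> sphere_grad \<phi> (boost e (s t) v) \<partial>\<mu>) * H (max 0 (s t))) (at t)"
      by (rule DERIV_chain2[OF has_derivative_integral_boost[OF \<mu> e \<phi>] s])
    moreover have "(\<integral>v. mean_vector (distr \<mu> sphere_borel (boost e (s t))) \<bullet> sphere_grad \<phi> v
          \<partial>distr \<mu> sphere_borel (boost e (s t))) =
        (\<integral>v. e \<bullet> sphere_grad \<phi> (boost e (s t) v) \<partial>\<mu>) * H (max 0 (s t))"
    proof -
      have "continuous_on unit_sphere (\<lambda>v. (H (s t) *\<^sub>R e) \<bullet> sphere_grad \<phi> v)"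
        by (intro continuous_intros cG)
      from int[OF this, of "s t"] show ?thesis
        using s_nonneg[OF t] by (simp add: m mH mult.commute)
    qed
    ultimately show "((\<lambda>t. \<integral>v. \<phi> v \<partial>distr \<mu> sphere_borel (boost e (s t))) has_real_derivative
        (\<integral>v. mean_vector (distr \<mu> sphere_borel (boost e (s t))) \<bullet> sphere_grad \<phi> v
          \<partial>distr \<mu> sphere_borel (boost e (s t)))) (at t within {0..})"
      unfolding int[OF c\<phi>] by (metis has_field_derivative_at_within)
  qed
  then show ?thesis using that[of s] s_nonneg s_le lim by blast
qed

section \<open>Convergence to the pole and the distance to it\<close>

lemma boost_weak_limit:
  fixes e :: "real ^ 'n"
  assumes \<mu>: "sphere_prob \<mu>" and e: "e \<in> unit_sphere" and ae: "AE v in \<mu>. e \<bullet> v \<noteq> -1"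
  shows "sphere_weak_tendsto (\<lambda>s. distr \<mu> sphere_borel (boost e s)) (return sphere_borel e) at_top"
  unfolding sphere_weak_tendsto_def
proof (intro allI impI)
  interpret prob_space \<mu> by (rule sphere_prob_prob_space[OF \<mu>])
  fix \<phi> :: "real ^ 'n \<Rightarrow> real" assume \<phi>: "continuous_on unit_sphere \<phi>"
  obtain B where B: "\<And>v. v \<in> unit_sphere \<Longrightarrow> norm (\<phi> v) \<le> B"
    using continuous_on_sphere_bounded[OF \<phi>] by blast
  have c: "continuous_on unit_sphere (\<lambda>v. \<phi> (boost e s v))" for s
    by (rule continuous_on_compose2[OF \<phi> continuous_on_boost[OF e]]) (use boost_in_sphere[OF e] in auto)
  have "((\<lambda>s. \<integral>v. \<phi> (boost e s v) \<partial>\<mu>) \<longlongrightarrow> (\<integral>v. \<phi> e \<partial>\<mu>)) at_top"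
  proof (rule integral_dominated_convergence_at_top[where w="\<lambda>_. B"])
    show "(\<lambda>v. \<phi> (boost e s v)) \<in> borel_measurable \<mu>" for s
      by (rule sphere_prob_measurable[OF \<mu> c])
    show "AE v in \<mu>. ((\<lambda>s. \<phi> (boost e s v)) \<longlongrightarrow> \<phi> e) at_top"
      using ae AE_space
    proof eventually_elim
      case (elim v)
      then have v: "v \<in> unit_sphere" by (simp add: sphere_prob_space[OF \<mu>])
      show ?case
        by (rule continuous_on_tendsto_compose[OF \<phi> boost_tendsto_axis[OF e v elim(1)]])
          (use e boost_in_sphere[OF e v] in auto)
    qed
    show "\<forall>\<^sub>F s in at_top. AE v in \<mu>. norm (\<phi> (boost e s v)) \<le> B"
      by (intro always_eventually allI AE_I2) (use B boost_in_sphere[OF e] in \<open>auto simp: sphere_prob_space[OF \<mu>]\<close>)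
  qed auto
  moreover have "(\<integral>v. \<phi> v \<partial>return sphere_borel e) = \<phi> e"
    using borel_measurable_sphere_borel[OF \<phi>] e by (intro integral_return) auto
  ultimately show "((\<lambda>s. \<integral>v. \<phi> v \<partial>distr \<mu> sphere_borel (boost e s)) \<longlongrightarrow> (\<integral>v. \<phi> v \<partial>return sphere_borel e)) at_top"
    by (simp add: integral_distr_sphere[OF \<mu> measurable_boost[OF e] \<phi>] prob_space)
qed

text \<open>Apart from inserting the test function, this needs that the supremum is taken over a bounded set.\<close>

lemma dist_le_W1:
  fixes \<mu> :: "(real ^ 'n) measure"
  assumes \<mu>: "sphere_prob \<mu>" and e: "e \<in> unit_sphere"
  shows "(\<integral>v. dist v e \<partial>\<mu>) \<le> W1 \<mu> (return sphere_borel e)"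
proof -
  interpret prob_space \<mu> by (rule sphere_prob_prob_space[OF \<mu>])
  have ret: "(\<integral>v. \<phi> v \<partial>return sphere_borel e) = \<phi> e"
    if "continuous_on unit_sphere \<phi>" for \<phi> :: "real ^ 'n \<Rightarrow> real"
    using borel_measurable_sphere_borel[OF that] e by (intro integral_return) auto
  have lip: "1-lipschitz_on unit_sphere (\<lambda>v. dist v e)"
  proof (rule lipschitz_onI)
    show "dist (dist x e) (dist y e) \<le> 1 * dist x y" for x y
      using dist_triangle[of x e y] dist_triangle[of y e x]
      by (simp add: dist_real_def abs_le_iff dist_commute)
  qed simp
  have "\<bar>(\<integral>v. dist v e \<partial>\<mu>) - (\<integral>v. dist v e \<partial>return sphere_borel e)\<bar> \<le> W1 \<mu> (return sphere_borel e)"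
    unfolding W1_def
  proof (rule cSUP_upper)
    show "(\<lambda>v. dist v e) \<in> {\<phi>. 1-lipschitz_on unit_sphere \<phi>}" using lip by simp
    show "bdd_above ((\<lambda>\<phi>. \<bar>(\<integral>v. (\<phi> v :: real) \<partial>\<mu>) - (\<integral>v. \<phi> v \<partial>return sphere_borel e)\<bar>) ` {\<phi>. 1-lipschitz_on unit_sphere \<phi>})"
    proof (rule bdd_aboveI2)
      fix \<phi> :: "real ^ 'n \<Rightarrow> real" assume "\<phi> \<in> {\<phi>. 1-lipschitz_on unit_sphere \<phi>}"
      then have L: "1-lipschitz_on unit_sphere \<phi>" by simp
      have c: "continuous_on unit_sphere \<phi>" by (rule lipschitz_on_continuous_on[OF L])
      have "norm (\<integral>v. \<phi> v - \<phi> e \<partial>\<mu>) \<le> 2"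
      proof (rule sphere_prob_integral_norm_le[OF \<mu>])
        show "continuous_on unit_sphere (\<lambda>v. \<phi> v - \<phi> e)" by (intro continuous_intros c)
        fix v :: "real ^ 'n" assume v: "v \<in> unit_sphere"
        have "norm (\<phi> v - \<phi> e) \<le> dist v e"
          using lipschitz_onD[OF L v e] by (simp add: dist_real_def)
        also have "\<dots> \<le> 2" using norm_triangle_ineq4[of v e] v e by (simp add: dist_norm)
        finally show "norm (\<phi> v - \<phi> e) \<le> 2" .
      qed
      then show "\<bar>(\<integral>v. \<phi> v \<partial>\<mu>) - (\<integral>v. \<phi> v \<partial>return sphere_borel e)\<bar> \<le> 2"
        using sphere_prob_integrable[OF \<mu> c] by (simp add: ret[OF c] prob_space)
    qed
  qed
  moreover have "(\<integral>v. dist v e \<partial>return sphere_borel e) = 0"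
    by (subst ret) (auto intro!: continuous_intros)
  ultimately show ?thesis by simp
qed


lemma sets_spherical_cap: "{v \<in> unit_sphere. e \<bullet> v \<le> c} \<in> sets (sphere_borel :: (real ^ 'n) measure)"
proof -
  have "closed (unit_sphere \<inter> {v :: real ^ 'n. e \<bullet> v \<le> c})"
    by (intro closed_Int closed_sphere closed_Collect_le continuous_intros)
  moreover have "{v \<in> unit_sphere. e \<bullet> v \<le> c} = unit_sphere \<inter> {v. e \<bullet> v \<le> c}" by auto
  ultimately show ?thesis by (simp add: sets_sphere_borel)
qed

text \<open>The test function is the distance to \<open>e\<close>, which is at least \<open>1\<close> on the hemisphere opposite to \<open>e\<close>. A
point with \<open>e \<bullet> v \<le> - tanh s\<close> is still in that hemisphere after the boost of rapidity \<open>s\<close>.\<close>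

lemma mass_le_W1_boost:
  fixes e :: "real ^ 'n"
  assumes \<mu>: "sphere_prob \<mu>" and e: "e \<in> unit_sphere" and s: "s \<le> t"
  shows "measure \<mu> {v \<in> unit_sphere. e \<bullet> v \<le> - tanh t} \<le> W1 (distr \<mu> sphere_borel (boost e s)) (return sphere_borel e)"
proof -
  interpret prob_space \<mu> by (rule sphere_prob_prob_space[OF \<mu>])
  define L where "L = {v \<in> unit_sphere. e \<bullet> v \<le> - tanh t}"
  have L: "L \<in> sets \<mu>"
    unfolding L_def sphere_prob_sets[OF \<mu>] by (rule sets_spherical_cap)
  have c: "continuous_on unit_sphere (\<lambda>v. dist v e)" by (intro continuous_intros)
  have cb: "continuous_on unit_sphere (\<lambda>v. dist (boost e s v) e)"
    by (intro continuous_intros continuous_on_boost[OF e])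
  have "measure \<mu> L = (\<integral>v. indicator L v \<partial>\<mu>)" using L by simp
  also have "\<dots> \<le> (\<integral>v. dist (boost e s v) e \<partial>\<mu>)"
  proof (rule integral_mono)
    show "integrable \<mu> (indicat_real L)"
      by (rule integrable_const_bound[of _ 1]) (use L in auto)
    show "integrable \<mu> (\<lambda>v. dist (boost e s v) e)" by (rule sphere_prob_integrable[OF \<mu> cb])
    fix v assume "v \<in> space \<mu>"
    then have v: "v \<in> unit_sphere" by (simp add: sphere_prob_space[OF \<mu>])
    show "indicat_real L v \<le> dist (boost e s v) e"
    proof (cases "v \<in> L")
      case True
      define b where "b = boost e s v"
      have "tanh s \<le> tanh t" using s by simp
      moreover have "e \<bullet> v \<le> - tanh t" using True by (simp add: L_def)
      ultimately have "e \<bullet> v \<le> - tanh s" by linarith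
      then have "cosh s * (e \<bullet> v) \<le> cosh s * (- tanh s)" by (intro mult_left_mono) auto
      then have "cosh s * (e \<bullet> v) + sinh s \<le> 0" by (simp add: tanh_def)
      then have "e \<bullet> b \<le> 0"
        unfolding b_def axis_inner_boost[OF e]
        using boost_denominator_pos[OF abs_inner_unit_le_1[OF e v], of s]
        by (simp add: divide_nonpos_pos)
      moreover have "(dist b e)\<^sup>2 = 2 - 2 * (e \<bullet> b)"
        using e boost_in_sphere[OF e v, of s]
        by (simp add: dist_norm power2_norm_eq_inner inner_diff_left inner_diff_right inner_commute norm_eq_1 b_def)
      ultimately have "1\<^sup>2 \<le> (dist b e)\<^sup>2" by simp
      then have "1 \<le> dist b e" by (rule power2_le_imp_le) simp
      then show ?thesis using True by (simp add: b_def)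
    qed simp
  qed
  also have "\<dots> = (\<integral>v. dist v e \<partial>distr \<mu> sphere_borel (boost e s))"
    by (rule integral_distr_sphere[OF \<mu> measurable_boost[OF e] c, symmetric])
  also have "\<dots> \<le> W1 (distr \<mu> sphere_borel (boost e s)) (return sphere_borel e)"
    by (rule dist_le_W1[OF sphere_prob_distr_boost[OF \<mu> e] e])
  finally show ?thesis by (simp add: L_def)
qed

section \<open>Surface measure\<close>

lemma measurable_sgn_sphere:
  "sgn \<in> measurable (restrict_space lborel (cball 0 1 - {0})) (sphere_borel :: (real ^ 'n) measure)"
proof -
  have "(sgn :: real ^ 'n \<Rightarrow> _) \<in> borel_measurable borel"
    unfolding sgn_div_norm[abs_def] by measurable
  then show ?thesis
    unfolding sphere_borel_def
    by (intro measurable_restrict_space2 measurable_restrict_space1)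
       (auto simp: space_restrict_space norm_sgn)
qed

lemma sets_sphere_measure [simp, measurable_cong]: "sets (sphere_measure :: (real ^ 'n) measure) = sets sphere_borel"
  by (simp add: sphere_measure_def)

lemma space_sphere_measure [simp]: "space (sphere_measure :: (real ^ 'n) measure) = unit_sphere"
  using sets_eq_imp_space_eq[OF sets_sphere_measure] by simp

lemma emeasure_sphere_measure:
  fixes A :: "(real ^ 'n) set"
  assumes A: "A \<in> sets sphere_borel"
  shows "emeasure sphere_measure A =
    of_nat CARD('n) * emeasure lborel {x \<in> cball 0 1 - {0}. sgn x \<in> A}"
proof -
  have "emeasure (distr (restrict_space lborel (cball 0 1 - {0})) sphere_borel sgn) A =
      emeasure (restrict_space lborel (cball 0 1 - {0})) {x \<in> cball 0 1 - {0}. sgn x \<in> A}"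
    using A by (subst emeasure_distr[OF measurable_sgn_sphere])
      (auto simp: space_restrict_space intro!: arg_cong2[where f=emeasure])
  also have "\<dots> = emeasure lborel {x \<in> cball 0 1 - {0}. sgn x \<in> A}"
    by (subst emeasure_restrict_space) auto
  finally show ?thesis by (simp add: sphere_measure_def)
qed

lemma finite_sphere_measure: "emeasure sphere_measure (A :: (real ^ 'n) set) < \<infinity>"
proof -
  have "emeasure (sphere_measure :: (real ^ 'n) measure) (space sphere_measure) =
      of_nat CARD('n) * emeasure lborel {x \<in> cball 0 1 - {0} :: (real ^ 'n) set. sgn x \<in> unit_sphere}"
    by (subst emeasure_sphere_measure) (auto simp: sets_sphere_borel)
  also have "\<dots> \<le> of_nat CARD('n) * emeasure lborel (cball 0 1 :: (real ^ 'n) set)"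
    by (intro mult_left_mono emeasure_mono) auto
  also have "\<dots> < \<infinity>"
    using emeasure_compact_finite[of "cball 0 1 :: (real ^ 'n) set"] by (simp add: ennreal_mult_less_top of_nat_less_top)
  finally show ?thesis
    using emeasure_space[of sphere_measure A] by (rule le_less_trans[rotated])
qed

lemma exists_unit_vector_with_axis_inner:
  fixes e :: "real ^ 'n"
  assumes n: "CARD('n::finite) \<ge> 2" and e: "e \<in> Basis" and c: "\<bar>c\<bar> \<le> 1"
  obtains v where "v \<in> unit_sphere" "e \<bullet> v = c"
proof -
  have "card (Basis :: (real ^ 'n) set) \<ge> 2" using n by simp
  moreover have "card {e} = 1" by simp
  ultimately have "card (Basis :: (real ^ 'n) set) \<noteq> card {e}" by linarith
  then have "Basis \<noteq> {e}" by metis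
  then obtain e' where e': "e' \<in> Basis" "e' \<noteq> e" using e by blast
  have "c\<^sup>2 \<le> 1" using c by (simp add: abs_square_le_1)
  define v where "v = c *\<^sub>R e + sqrt (1 - c\<^sup>2) *\<^sub>R e'"
  have "v \<bullet> v = c\<^sup>2 + (sqrt (1 - c\<^sup>2))\<^sup>2"
    using e e' by (simp add: v_def inner_add_left inner_add_right inner_Basis power2_eq_square)
  then have "v \<bullet> v = 1" using \<open>c\<^sup>2 \<le> 1\<close> by simp
  then have "v \<in> unit_sphere" by (simp add: norm_eq_1)
  moreover have "e \<bullet> v = c" using e e' by (simp add: v_def inner_add_right inner_Basis)
  ultimately show ?thesis by (rule that)
qed

text \<open>The cone over the zone \<open>a < e \<bullet> v < b\<close> contains a nonempty open set.\<close>

lemma sphere_measure_pos: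
  fixes e :: "real ^ 'n"
  assumes n: "CARD('n::finite) \<ge> 2" and e: "e \<in> Basis" and ab: "-1 \<le> a" "a < b" "b \<le> 1"
    and A: "A \<in> sets sphere_borel" and sub: "\<And>v. v \<in> unit_sphere \<Longrightarrow> a < e \<bullet> v \<Longrightarrow> e \<bullet> v < b \<Longrightarrow> v \<in> A"
  shows "0 < emeasure sphere_measure A"
proof -
  obtain v where v: "v \<in> unit_sphere" "e \<bullet> v = (a + b) / 2"
    by (rule exists_unit_vector_with_axis_inner[OF n e, of "(a + b) / 2"]) (use ab in auto)
  define U where "U = {x :: real ^ 'n. 0 < norm x \<and> norm x < 1 \<and> a * norm x < e \<bullet> x \<and> e \<bullet> x < b * norm x}"
  have "open U" unfolding U_def by (intro open_Collect_conj open_Collect_less continuous_intros)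
  moreover have "(1 / 2) *\<^sub>R v \<in> U" using v ab norm_zero[where 'a="real ^ 'n"] by (auto simp: U_def)
  ultimately obtain r where r: "r > 0" "ball ((1 / 2) *\<^sub>R v) r \<subseteq> U"
    using open_contains_ball by blast
  have U: "U \<subseteq> {x \<in> cball 0 1 - {0}. sgn x \<in> A}"
  proof
    fix x assume x: "x \<in> U"
    then have "sgn x \<in> A"
      by (intro sub) (auto simp: U_def norm_sgn sgn_div_norm field_simps)
    then show "x \<in> {x \<in> cball 0 1 - {0}. sgn x \<in> A}" using x by (auto simp: U_def)
  qed
  have m: "{x \<in> cball 0 1 - {0}. sgn x \<in> A} \<in> sets lborel"
    using measurable_sets[OF measurable_sgn_sphere A]
    by (auto simp: sets_restrict_space_iff space_restrict_space vimage_def Int_def conj_commute)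
  have "emeasure lborel (ball ((1 / 2) *\<^sub>R v) r) > 0"
    using content_ball_pos[OF r(1), of "(1 / 2) *\<^sub>R v"] by (auto simp: measure_def zero_less_iff_neq_zero)
  also have "\<dots> \<le> emeasure lborel {x \<in> cball 0 1 - {0}. sgn x \<in> A}"
    using r U m by (intro emeasure_mono) auto
  finally show ?thesis
    by (simp add: emeasure_sphere_measure[OF A] ennreal_zero_less_mult_iff)
qed

lemma distr_lborel_axis_flip:
  fixes e :: "real ^ 'n"
  assumes e: "e \<in> Basis"
  shows "distr lborel borel (axis_flip e) = lborel"
proof -
  define c where "c j = (if j = e then 1 else -1 :: real)" for j :: "real ^ 'n"
  have "(\<lambda>x. 0 + (\<Sum>j\<in>Basis. (c j * (x \<bullet> j)) *\<^sub>R j)) = axis_flip e"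
  proof (rule ext, rule euclidean_eqI)
    fix x b :: "real ^ 'n" assume b: "b \<in> Basis"
    have "(0 + (\<Sum>j\<in>Basis. (c j * (x \<bullet> j)) *\<^sub>R j)) \<bullet> b = c b * (x \<bullet> b)"
      using b by (simp add: inner_sum_left inner_Basis if_distrib cong: if_cong)
    also have "\<dots> = axis_flip e x \<bullet> b"
      using b e by (auto simp: c_def axis_flip_def inner_diff_left inner_Basis inner_commute[of e])
    finally show "(0 + (\<Sum>j\<in>Basis. (c j * (x \<bullet> j)) *\<^sub>R j)) \<bullet> b = axis_flip e x \<bullet> b" .
  qed
  moreover have "(\<Prod>j\<in>Basis. \<bar>c j\<bar>) = 1"
    by (rule prod.neutral) (simp add: c_def)
  moreover have "c j \<noteq> 0" for j by (simp add: c_def)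
  ultimately show ?thesis
    using lborel_affine_euclidean[of c 0] by (simp add: density_1)
qed

lemma axis_inner_axis_flip: "e \<in> unit_sphere \<Longrightarrow> e \<bullet> axis_flip e v = e \<bullet> v"
  by (simp add: axis_flip_def inner_diff_right norm_eq_1)

text \<open>The half-turn is linear and preserves norms and Lebesgue measure, so it maps the cone over a set to the
cone over the image.\<close>

lemma distr_sphere_measure_axis_flip:
  fixes e :: "real ^ 'n"
  assumes e: "e \<in> Basis"
  shows "distr sphere_measure sphere_borel (axis_flip e) = sphere_measure"
proof (rule measure_eqI)
  have eS: "e \<in> unit_sphere" using e by simp
  have flip: "axis_flip e \<in> measurable sphere_measure sphere_borel"
    using measurable_axis_flip[OF eS] by (simp cong: measurable_cong_sets)
  have norm_flip: "norm (axis_flip e x) = norm x" for x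
  proof -
    have "axis_flip e x \<bullet> axis_flip e x = x \<bullet> x"
      using eS by (simp add: axis_flip_def inner_diff_left inner_diff_right inner_commute[of x e] norm_eq_1 algebra_simps)
    then show ?thesis by (simp add: norm_eq_sqrt_inner)
  qed
  have sgn_flip: "sgn (axis_flip e x) = axis_flip e (sgn x)" for x
    using linear_scale[OF bounded_linear.linear[OF bounded_linear_axis_flip], of e]
    by (simp add: sgn_div_norm norm_flip)
  have flip0: "axis_flip e x = 0 \<longleftrightarrow> x = 0" for x
    using norm_flip[of x] by (metis norm_eq_zero)
  fix A assume "A \<in> sets (distr sphere_measure sphere_borel (axis_flip e))"
  then have A: "A \<in> sets sphere_borel" by simp
  define C where "C = {x \<in> cball 0 1 - {0}. sgn x \<in> A}"
  have C: "C \<in> sets borel"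
    using measurable_sets[OF measurable_sgn_sphere A]
    by (auto simp: C_def sets_restrict_space_iff space_restrict_space vimage_def Int_def conj_commute)
  have "emeasure (distr sphere_measure sphere_borel (axis_flip e)) A =
      emeasure sphere_measure (axis_flip e -` A \<inter> unit_sphere)"
    using emeasure_distr[OF flip A] by simp
  also have "\<dots> = of_nat CARD('n) * emeasure lborel {x \<in> cball 0 1 - {0}. sgn x \<in> axis_flip e -` A \<inter> unit_sphere}"
    using measurable_sets[OF measurable_axis_flip[OF eS] A] by (intro emeasure_sphere_measure) simp
  also have "{x \<in> cball 0 1 - {0}. sgn x \<in> axis_flip e -` A \<inter> unit_sphere} = axis_flip e -` C"
    by (auto simp: C_def norm_flip sgn_flip flip0 norm_sgn)
  also have "emeasure lborel (axis_flip e -` C) = emeasure (distr lborel borel (axis_flip e)) C"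
    using C linear_continuous_on[OF bounded_linear_axis_flip[of e]]
    by (subst emeasure_distr) (auto intro: borel_measurable_continuous_onI)
  finally show "emeasure (distr sphere_measure sphere_borel (axis_flip e)) A = emeasure sphere_measure A"
    by (simp add: distr_lborel_axis_flip[OF e] C_def emeasure_sphere_measure[OF A])
qed simp

lemma distr_density_axis_flip:
  fixes e :: "real ^ 'n"
  assumes e: "e \<in> Basis" and h: "h \<in> borel_measurable sphere_measure"
    and inv: "\<And>v. v \<in> unit_sphere \<Longrightarrow> h (axis_flip e v) = h v"
  shows "distr (density sphere_measure h) sphere_borel (axis_flip e) = density sphere_measure h"
proof -
  have eS: "e \<in> unit_sphere" using e by simp
  have flip: "axis_flip e \<in> measurable sphere_measure sphere_borel"
    using measurable_axis_flip[OF eS] by (simp cong: measurable_cong_sets)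
  have h': "h \<in> borel_measurable sphere_borel" using h by (simp cong: measurable_cong_sets)
  have "density sphere_measure h = density (distr sphere_measure sphere_borel (axis_flip e)) h"
    by (simp only: distr_sphere_measure_axis_flip[OF e])
  also have "\<dots> = distr (density sphere_measure (\<lambda>v. h (axis_flip e v))) sphere_borel (axis_flip e)"
    by (rule density_distr[OF h' flip])
  also have "density sphere_measure (\<lambda>v. h (axis_flip e v)) = density sphere_measure h"
    using h measurable_compose[OF flip h'] inv by (intro density_cong) auto
  finally show ?thesis by (rule sym)
qed

section \<open>A density that escapes slowly\<close>

lemma density_with_prescribed_masses:
  fixes A :: "nat \<Rightarrow> 'a set" and p :: "nat \<Rightarrow> real"
  assumes A: "\<And>k. A k \<in> sets M" and disj: "disjoint_family A"
    and pos: "\<And>k. 0 < emeasure M (A k)" and fin: "\<And>k. emeasure M (A k) < \<infinity>"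
    and p: "\<And>k. 0 \<le> p k" and sums: "p sums 1"
  obtains h where "h \<in> borel_measurable M" "\<And>v. 0 \<le> h v" "\<And>v. \<forall>k. v \<notin> A k \<Longrightarrow> h v = 0"
    "\<And>v w. \<forall>k. v \<in> A k \<longleftrightarrow> w \<in> A k \<Longrightarrow> h v = h w"
    "\<And>k. emeasure (density M (\<lambda>v. ennreal (h v))) (A k) = ennreal (p k)"
    "(\<integral>\<^sup>+v. ennreal (h v) \<partial>M) = 1"
proof -
  define h where "h v = (\<Sum>k. p k / measure M (A k) * indicator (A k) v)" for v
  have h_in: "h v = p k / measure M (A k)" if "v \<in> A k" for k v
  proof -
    have "v \<notin> A j" if "j \<noteq> k" for j using disj \<open>v \<in> A k\<close> that by (auto simp: disjoint_family_on_def)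
    then have "h v = (\<Sum>j\<in>{k}. p j / measure M (A j) * indicator (A j) v)"
      unfolding h_def by (intro suminf_finite) auto
    then show ?thesis using that by simp
  qed
  have h_out: "h v = 0" if "\<forall>k. v \<notin> A k" for v
    using that by (simp add: h_def)
  have meas: "h \<in> borel_measurable M"
    unfolding h_def using A by measurable
  have nonneg: "0 \<le> h v" for v
    using h_in h_out p by (cases "\<exists>k. v \<in> A k") (auto simp: divide_nonneg_nonneg)
  have mass: "emeasure (density M (\<lambda>v. ennreal (h v))) (A k) = ennreal (p k)" for k
  proof -
    have "emeasure (density M (\<lambda>v. ennreal (h v))) (A k) = (\<integral>\<^sup>+v. ennreal (h v) * indicator (A k) v \<partial>M)"
      using meas A by (intro emeasure_density) auto
    also have "\<dots> = (\<integral>\<^sup>+v. ennreal (p k / measure M (A k)) * indicator (A k) v \<partial>M)"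
      by (intro nn_integral_cong) (auto simp: h_in split: split_indicator)
    also have "\<dots> = ennreal (p k / measure M (A k)) * emeasure M (A k)"
      using A by (simp add: nn_integral_cmult_indicator)
    also have "\<dots> = ennreal (p k)"
    proof -
      have "emeasure M (A k) = ennreal (measure M (A k))"
        using fin[of k] by (simp add: emeasure_eq_ennreal_measure less_top)
      moreover have "measure M (A k) > 0" using pos[of k] calculation by (simp add: ennreal_less_zero_iff)
      ultimately show ?thesis using p[of k] by (simp flip: ennreal_mult)
    qed
    finally show ?thesis .
  qed
  have "(\<integral>\<^sup>+v. ennreal (h v) \<partial>M) = (\<integral>\<^sup>+v. ennreal (h v) * indicator (\<Union>k. A k) v \<partial>M)"
    by (intro nn_integral_cong) (auto simp: h_out split: split_indicator)
  also have "\<dots> = emeasure (density M (\<lambda>v. ennreal (h v))) (\<Union>k. A k)"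
    using meas A by (intro emeasure_density[symmetric]) auto
  also have "\<dots> = (\<Sum>k. emeasure (density M (\<lambda>v. ennreal (h v))) (A k))"
    using A disj by (intro suminf_emeasure[symmetric]) auto
  also have "\<dots> = ennreal 1"
    unfolding mass using sums p by (simp add: suminf_ennreal2 sums_iff)
  finally have "(\<integral>\<^sup>+v. ennreal (h v) \<partial>M) = 1" by simp
  moreover have "h v = h w" if "\<forall>k. v \<in> A k \<longleftrightarrow> w \<in> A k" for v w
    using that by (simp add: h_def indicator_def)
  ultimately show ?thesis using that[of h] meas nonneg h_out mass by blast
qed

lemma sphere_prob_density:
  assumes "sphere_pdf f0"
  shows "sphere_prob (density sphere_measure (\<lambda>v. ennreal (f0 v)) :: (real ^ 'n) measure)"
  unfolding sphere_prob_def
proof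
  show "prob_space (density sphere_measure (\<lambda>v. ennreal (f0 v)))"
  proof (rule prob_spaceI)
    have "emeasure (density sphere_measure (\<lambda>v. ennreal (f0 v))) (space sphere_measure) =
        (\<integral>\<^sup>+v. ennreal (f0 v) * indicator (space sphere_measure) v \<partial>sphere_measure)"
      using assms by (intro emeasure_density) (auto simp: sphere_pdf_def sets_sphere_borel)
    also have "\<dots> = (\<integral>\<^sup>+v. ennreal (f0 v) \<partial>sphere_measure)"
      by (intro nn_integral_cong) simp
    finally show "emeasure (density sphere_measure (\<lambda>v. ennreal (f0 v)))
        (space (density sphere_measure (\<lambda>v. ennreal (f0 v)))) = 1"
      using assms by (simp add: sphere_pdf_def)
  qed
qed simp

text \<open>Disjoint sets \<open>A k\<close> receive the masses \<open>p k\<close>: \<open>A 0\<close> is a cap around \<open>e\<close> with mass \<open>1 - g 0\<close>, and \<open>A (j + 1)\<close> is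
the shell \<open>- tanh (j + 2) < e \<bullet> v \<le> - tanh (j + 1)\<close> with mass \<open>g j - g (j + 1)\<close>. The shells from index \<open>j\<close> on
have total mass \<open>g j\<close> by telescoping. They lie in \<open>{e \<bullet> v \<le> - tanh t}\<close> for all \<open>t \<le> j + 1\<close>, and \<open>g t \<le> g j\<close>
for \<open>j \<le> t\<close>.\<close>

lemma exists_slowly_escaping_density:
  fixes g :: "real \<Rightarrow> real" and e :: "real ^ 'n"
  assumes n: "CARD('n::finite) \<ge> 2" and anti: "antimono_on {0..} g" and lim: "(g \<longlongrightarrow> 0) at_top"
    and g0: "g 0 < 1 / 2" and e: "e \<in> Basis"
  obtains f0 :: "real ^ 'n \<Rightarrow> real" where "sphere_pdf f0"
    "\<And>v. v \<in> unit_sphere \<Longrightarrow> f0 (axis_flip e v) = f0 v"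
    "AE v in density sphere_measure (\<lambda>v. ennreal (f0 v)). e \<bullet> v \<noteq> -1"
    "0 < e \<bullet> mean_vector (density sphere_measure (\<lambda>v. ennreal (f0 v)))"
    "\<And>t. t \<ge> 0 \<Longrightarrow> g t \<le> measure (density sphere_measure (\<lambda>v. ennreal (f0 v))) {v \<in> unit_sphere. e \<bullet> v \<le> - tanh t}"
proof -
  have eS: "e \<in> unit_sphere" using e by simp
  have anti: "g y \<le> g x" if "0 \<le> x" "x \<le> y" for x y
    using anti that by (auto simp: monotone_on_def)
  have g_nonneg: "0 \<le> g x" if "0 \<le> x" for x
  proof (rule tendsto_upperbound[OF lim])
    show "\<forall>\<^sub>F y in at_top. g y \<le> g x"
      using eventually_ge_at_top[of x] by eventually_elim (rule anti[OF that])
  qed simp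
  \<comment> \<open>the height of the cap: since \<open>e \<bullet> v \<ge> -1\<close> off the cap, the mean has component at least \<open>(1 + r) * (1 - g 0) - 1 > 0\<close>\<close>
  define r where "r = 1 / (2 * (1 - g 0))"
  have r: "0 < r" "r < 1" "(1 + r) * (1 - g 0) > 1"
  proof -
    have "r * (1 - g 0) = 1 / 2" using g0 by (simp add: r_def)
    then show "(1 + r) * (1 - g 0) > 1" using g0 by (simp add: distrib_right)
  qed (use g0 g_nonneg[of 0] in \<open>auto simp: r_def field_simps\<close>)
  define p where "p k = (case k of 0 \<Rightarrow> 1 - g 0 | Suc j \<Rightarrow> g (real j) - g (real (Suc j)))" for k
  define a where "a k = tanh (real k)" for k
  define A where "A k = (case k of 0 \<Rightarrow> {v :: real ^ 'n. norm v = 1 \<and> r < e \<bullet> v}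
      | Suc j \<Rightarrow> {v. norm v = 1 \<and> - a (Suc (Suc j)) < e \<bullet> v \<and> e \<bullet> v \<le> - a (Suc j)})" for k
  have a_mono: "a j \<le> a k \<longleftrightarrow> j \<le> k" "a j < a k \<longleftrightarrow> j < k" for j k by (simp_all add: a_def)
  have a_less_1: "a k < 1" for k using tanh_real_lt_1[of "real k"] by (simp add: a_def)
  have a_nonneg: "0 \<le> a k" for k by (simp add: a_def)
  have p_nonneg: "0 \<le> p k" for k
    using g0 anti by (auto simp: p_def split: nat.split)
  have lim_nat: "(\<lambda>k. g (real (k + j))) \<longlonglongrightarrow> 0" for j
    by (rule LIMSEQ_ignore_initial_segment[where f="\<lambda>k. g (real k)",
        OF filterlim_compose[OF lim filterlim_real_sequentially]])
  have p_tail: "(\<lambda>k. p (Suc (k + j))) sums g (real j)" for j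
    using telescope_sums'[OF lim_nat[of j]] by (simp add: p_def add_ac)
  have p_sums: "p sums 1"
    using sums_Suc[of p, OF p_tail[of 0, simplified]] by (simp add: p_def)
  have A_sub: "A k \<subseteq> unit_sphere" for k by (auto simp: A_def split: nat.splits)
  have A_sets: "A k \<in> sets sphere_measure" for k
  proof -
    have "A k \<in> sets borel" unfolding A_def by (cases k) (simp_all, measurable)
    then show ?thesis using A_sub by (auto simp: sets_sphere_borel)
  qed
  have A_pos: "0 < emeasure sphere_measure (A k)" for k
  proof (cases k)
    case 0
    show ?thesis
      by (rule sphere_measure_pos[OF n e, of r 1]) (use r A_sets[of k] 0 in \<open>auto simp: A_def\<close>)
  next
    case (Suc j)
    show ?thesis
      by (rule sphere_measure_pos[OF n e, of "- a (Suc (Suc j))" "- a (Suc j)"])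
        (use A_sets[of k] Suc a_less_1[of "Suc (Suc j)"] a_nonneg[of "Suc j"] in \<open>auto simp: A_def a_mono\<close>)
  qed
  have disj: "disjoint_family A"
    unfolding disjoint_family_on_def
  proof (intro ballI impI)
    have *: "A j \<inter> A k = {}" if jk: "j < k" for j k
    proof -
      obtain i where k: "k = Suc i" using jk by (cases k) auto
      show ?thesis
      proof (cases j)
        case 0
        then show ?thesis using k r a_nonneg[of "Suc i"] by (auto simp: A_def)
      next
        case (Suc l)
        then have "a (Suc (Suc l)) \<le> a (Suc i)" using jk k by (simp add: a_mono)
        then show ?thesis using Suc k by (auto simp: A_def)
      qed
    qed
    fix j k :: nat assume "j \<noteq> k"
    then show "A j \<inter> A k = {}" using *[of j k] *[of k j] by (cases "j < k") auto
  qed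
  obtain f0 where f0: "f0 \<in> borel_measurable sphere_measure" "\<And>v. 0 \<le> f0 v"
      "\<And>v. \<forall>k. v \<notin> A k \<Longrightarrow> f0 v = 0" "\<And>v w. \<forall>k. v \<in> A k \<longleftrightarrow> w \<in> A k \<Longrightarrow> f0 v = f0 w"
      "\<And>k. emeasure (density sphere_measure (\<lambda>v. ennreal (f0 v))) (A k) = ennreal (p k)"
      "(\<integral>\<^sup>+v. ennreal (f0 v) \<partial>sphere_measure) = 1"
    by (rule density_with_prescribed_masses[OF A_sets disj A_pos finite_sphere_measure p_nonneg p_sums]) (rule that)
  define \<mu> where "\<mu> = density sphere_measure (\<lambda>v. ennreal (f0 v))"
  have pdf: "sphere_pdf f0" using f0(1,2,6) by (simp add: sphere_pdf_def)
  have \<mu>: "sphere_prob \<mu>" unfolding \<mu>_def by (rule sphere_prob_density[OF pdf])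
  interpret prob_space \<mu> by (rule sphere_prob_prob_space[OF \<mu>])
  have A_\<mu>: "A k \<in> sets \<mu>" for k using A_sets[of k] by (simp add: \<mu>_def)
  have mass: "measure \<mu> (A k) = p k" for k
    using f0(5)[of k] p_nonneg[of k] by (simp add: \<mu>_def[symmetric] measure_def)
  have inv: "f0 (axis_flip e v) = f0 v" if "v \<in> unit_sphere" for v
  proof (rule f0(4))
    have "axis_flip e v \<in> unit_sphere" by (rule axis_flip_in_sphere[OF eS that])
    then show "\<forall>k. axis_flip e v \<in> A k \<longleftrightarrow> v \<in> A k"
      using that by (auto simp: A_def axis_inner_axis_flip[OF eS] split: nat.splits)
  qed
  have ae: "AE v in \<mu>. e \<bullet> v \<noteq> -1"
    unfolding \<mu>_def
  proof (subst AE_density)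
    show "(\<lambda>v. ennreal (f0 v)) \<in> borel_measurable sphere_measure" using f0(1) by simp
    show "AE v in sphere_measure. 0 < ennreal (f0 v) \<longrightarrow> e \<bullet> v \<noteq> -1"
    proof (intro AE_I2 impI)
      fix v assume "0 < ennreal (f0 v)"
      then obtain k where k: "v \<in> A k" using f0(3)[of v] by fastforce
      show "e \<bullet> v \<noteq> -1"
      proof (cases k)
        case 0
        then show ?thesis using k r by (simp add: A_def)
      next
        case (Suc j)
        then show ?thesis using k a_less_1[of "Suc (Suc j)"] by (simp add: A_def)
      qed
    qed
  qed
  have mean: "0 < e \<bullet> mean_vector \<mu>"
  proof -
    have ind: "integrable \<mu> (indicat_real (A 0))"
      by (rule integrable_const_bound[of _ 1]) (use A_\<mu>[of 0] in auto)
    have "1 < (1 + r) * measure \<mu> (A 0)" using r by (simp add: mass p_def)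
    then have "0 < (1 + r) * measure \<mu> (A 0) - 1" by simp
    also have "\<dots> = (\<integral>v. (1 + r) * indicator (A 0) v - 1 \<partial>\<mu>)"
      using ind A_\<mu>[of 0] by (simp add: Bochner_Integration.integral_diff prob_space)
    also have "\<dots> \<le> (\<integral>v. e \<bullet> v \<partial>\<mu>)"
    proof (rule integral_mono)
      show "integrable \<mu> (\<lambda>v. (1 + r) * indicator (A 0) v - 1)" using ind by simp
      show "integrable \<mu> (\<lambda>v. e \<bullet> v)" using integrable_id_sphere[OF \<mu>] by simp
      fix v assume "v \<in> space \<mu>"
      then have "v \<in> unit_sphere" by (simp add: sphere_prob_space[OF \<mu>])
      then show "(1 + r) * indicator (A 0) v - 1 \<le> e \<bullet> v"
        using abs_inner_unit_le_1[OF eS, of v] by (auto simp: A_def indicator_def)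
    qed
    also have "\<dots> = e \<bullet> mean_vector \<mu>"
      using integrable_id_sphere[OF \<mu>] by (simp add: mean_vector_def)
    finally show ?thesis .
  qed
  have tail: "g t \<le> measure \<mu> {v \<in> unit_sphere. e \<bullet> v \<le> - tanh t}" if t: "t \<ge> 0" for t
  proof -
    define j where "j = nat \<lfloor>t\<rfloor>"
    have j: "real j \<le> t" "t \<le> real (Suc j)" using t unfolding j_def by linarith+
    have "(\<lambda>k. measure \<mu> (A (Suc (k + j)))) sums measure \<mu> (\<Union>k. A (Suc (k + j)))"
      by (rule finite_measure_UNION) (use A_\<mu> disj in \<open>auto simp: disjoint_family_on_def\<close>)
    then have "measure \<mu> (\<Union>k. A (Suc (k + j))) = g (real j)"
      using p_tail[of j] by (simp add: mass sums_iff)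
    moreover have "measure \<mu> (\<Union>k. A (Suc (k + j))) \<le> measure \<mu> {v \<in> unit_sphere. e \<bullet> v \<le> - tanh t}"
    proof (rule finite_measure_mono)
      show "(\<Union>k. A (Suc (k + j))) \<subseteq> {v \<in> unit_sphere. e \<bullet> v \<le> - tanh t}"
      proof (rule UN_least)
        fix k
        have "tanh t \<le> a (Suc (k + j))" using j by (simp add: a_def)
        then show "A (Suc (k + j)) \<subseteq> {v \<in> unit_sphere. e \<bullet> v \<le> - tanh t}"
          by (auto simp: A_def)
      qed
      show "{v \<in> unit_sphere. e \<bullet> v \<le> - tanh t} \<in> sets \<mu>"
        unfolding sphere_prob_sets[OF \<mu>] by (rule sets_spherical_cap)
    qed
    ultimately show ?thesis using anti[of "real j" t] j by simp
  qed
  show ?thesis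
    using that[of f0] pdf inv ae mean tail unfolding \<mu>_def by blast
qed

theorem proposition6:
  fixes g :: "real \<Rightarrow> real"
  assumes "CARD('n::finite) \<ge> 2"
    and "smooth_halfline g"
    and "antimono_on {0..} g"
    and "(g \<longlongrightarrow> 0) at_top"
    and "g 0 < 1 / 2"
  shows "\<exists>f0 :: real ^ 'n \<Rightarrow> real. sphere_pdf f0 \<and>
    (\<exists>f. is_the_alignment_solution (density sphere_measure (\<lambda>v. ennreal (f0 v))) f \<and>
      (\<exists>\<Omega>\<in>unit_sphere.
        sphere_weak_tendsto f (return sphere_borel \<Omega>) at_top \<and>
        (\<forall>t\<ge>0. W1 (f t) (return sphere_borel \<Omega>) \<ge> g t)))"
proof -
  obtain e :: "real ^ 'n" where e: "e \<in> Basis" using nonempty_Basis by blast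
  have eS: "e \<in> unit_sphere" using e by simp
  obtain f0 :: "real ^ 'n \<Rightarrow> real" where pdf: "sphere_pdf f0"
    and inv: "\<And>v. v \<in> unit_sphere \<Longrightarrow> f0 (axis_flip e v) = f0 v"
    and ae: "AE v in density sphere_measure (\<lambda>v. ennreal (f0 v)). e \<bullet> v \<noteq> -1"
    and mean: "0 < e \<bullet> mean_vector (density sphere_measure (\<lambda>v. ennreal (f0 v)))"
    and tail: "\<And>t. t \<ge> 0 \<Longrightarrow> g t \<le> measure (density sphere_measure (\<lambda>v. ennreal (f0 v))) {v \<in> unit_sphere. e \<bullet> v \<le> - tanh t}"
    by (rule exists_slowly_escaping_density[OF assms(1,3,4,5) e]) (rule that)
  define \<mu> where "\<mu> = density sphere_measure (\<lambda>v. ennreal (f0 v))"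
  have \<mu>: "sphere_prob \<mu>" unfolding \<mu>_def by (rule sphere_prob_density[OF pdf])
  have flip: "distr \<mu> sphere_borel (axis_flip e) = \<mu>"
    unfolding \<mu>_def using pdf inv by (intro distr_density_axis_flip[OF e]) (auto simp: sphere_pdf_def)
  obtain s where s: "\<And>t. t \<ge> 0 \<Longrightarrow> 0 \<le> s t \<and> s t \<le> t" "filterlim s at_top at_top"
    and sol: "alignment_solution \<mu> (\<lambda>t. distr \<mu> sphere_borel (boost e (s t)))"
    by (rule axisymmetric_solution[OF eS \<mu> flip mean[folded \<mu>_def]]) (rule that)
  define f where "f t = distr \<mu> sphere_borel (boost e (s t))" for t
  have "is_the_alignment_solution \<mu> f"
    using sol alignment_solution_unique[OF _ sol] by (simp add: is_the_alignment_solution_def f_def[abs_def])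
  moreover have "sphere_weak_tendsto f (return sphere_borel e) at_top"
    using boost_weak_limit[OF \<mu> eS ae[folded \<mu>_def]] filterlim_compose[OF _ s(2)]
    unfolding sphere_weak_tendsto_def f_def by blast
  moreover have "g t \<le> W1 (f t) (return sphere_borel e)" if "t \<ge> 0" for t
    using tail[OF that] mass_le_W1_boost[OF \<mu> eS, of "s t" t] s(1)[OF that] by (simp add: f_def \<mu>_def)
  ultimately show ?thesis using pdf eS unfolding \<mu>_def by blast
qed

end
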